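(* Let $n\ge1$, $n\ge k\ge 0$, and let $g:[0,\infty)^n\to\mathbb{R}$ be a continuous PDI$_{k,n}^\infty$ function such that $g(t)=0$ for every $t\in\partial_{k-1}^n$. Let $\eta$ be the nonnegative measure in the integral representation of $g$ recalled in the context. (a) The function $g$ is SPDI$_{k,n}^\infty$ if and only if $\eta((0,\infty)^n)>0$. (b) If $n\ge k\ge 2$, then $g$ is SPDI$_{k,n}^\infty$ if and only if for every $d\in\mathbb{N}$ and every discrete probability $P$ in $(\mathbb{R}^d)^n$ the following equivalence holds: $$\int_{(\mathbb{R}^d)^n}\int_{(\mathbb{R}^d)^n}g(\|x_1-y_1\|^2,\ldots,\|x_n-y_n\|^2)\,d[\Lambda_k^n[P]](x)\,d[\Lambda_k^n[P]](y)=0\iff \Lambda_k^n[P]=0.$$ (c) If $k=n\ge 2$, then $g$ is SPDI$_{n,n}^\infty$ if and only if for every $d\in\mathbb{N}$ and every discrete probability $P$ in $(\mathbb{R}^d)^n$ the following equivalence holds: $$\int_{(\mathbb{R}^d)^n}\int_{(\mathbb{R}^d)^n}(-1)^ng(\|x_1-y_1\|^2,\ldots,\|x_n-y_n\|^2)\,d[\Sigma[P]](x)\,d[\Sigma[P]](y)=0\iff\Sigma[P]=0.$$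
   Context: A discrete measure is a finite real linear combination of Dirac measures. $\mathfrak{M}(A)$ denotes the finite (signed) Borel measures on $A$. $\partial_{k-1}^n:=\{r\in[0,\infty)^n:\ |\{i: r_i>0\}|<k\}$ for $0\le k\le n+1$ (so $\partial_{-1}^n=\emptyset$). $\mathcal{M}_k(\prod_{i=1}^n X_i)$ is the space of discrete measures $\mu$ in $\prod_iX_i$ such that $\mu(\prod_iA_i)=0$ for all $A_i\subset X_i$ with $|\{i:A_i=X_i\}|\ge n-k+1$. $g:[0,\infty)^n\to\mathbb{R}$ is PDI$_{k,n}^\infty$ if for every $d\in\mathbb{N}$ and $\mu\in\mathcal{M}_k((\mathbb{R}^d)^n)$ (product of $n$ copies of $\mathbb{R}^d$), $$\int_{(\mathbb{R}^d)^n}\int_{(\mathbb{R}^d)^n}(-1)^kg(\|u_1-v_1\|^2,\ldots,\|u_n-v_n\|^2)\,d\mu(u)\,d\mu(v)\ge0;$$ it is SPDI$_{k,n}^\infty$ if in addition, for every $d$, equality holds only when $\mu$ is the zero measure. Integral representation. Every continuous PDI$_{k,n}^\infty$ function $g$ vanishing on $\partial_{k-1}^n$ has a unique representation of the following form: - if $k=0$: $g(t)=\int_{[0,\infty)^n}e^{-r\cdot t}\,d\eta(r)$ with $\eta\in\mathfrak{M}([0,\infty)^n)$ nonnegative; - if $k=n\ge1$: $g(t)=\int_{[0,\infty)^n}\prod_{i=1}^n(1-e^{-r_it_i})\frac{1+r_i}{r_i}\,d\eta(r)$ with $\eta\in\mathfrak{M}([0,\infty)^n)$ nonnegative, where $(1-e^{-r_it_i})\frac{1+r_i}{r_i}$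 is defined as $t_i$ when $r_i=0$; - if $1\le k<n$: $g(t)=\sum_{|F|=k}\psi^F(t_F)+\int_{[0,\infty)^n\setminus\partial_k^n}(-1)^kE_k^n(r\odot t)\frac{p_k^n(r+\vec1)}{p_k^n(r)}\,d\eta(r)$ with $\eta\in\mathfrak{M}([0,\infty)^n\setminus\partial_k^n)$ nonnegative and $\psi^F:[0,\infty)^k\to\mathbb{R}$ continuous Bernstein functions of order $k$ in $(0,\infty)^k$, zero on $\partial_{k-1}^k$. Here $F$ ranges over subsets of $\{1,\dots,n\}$, $t_F=(t_i)_{i\in F}$, $r\odot t=(r_1t_1,\dots,r_nt_n)$, $\vec1=(1,\dots,1)$, $p_k^n$ is the $k$-th elementary symmetric polynomial in $n$ variables, and $E_k^n(s)=H_k^n(e^{-s_1},\dots,e^{-s_n})$ with $H_k^n(r)=p_n^n(r)+\sum_{j=0}^{k-1}(-1)^{k-j}\binom{n-j-1}{n-k}p_j^n(r)$. A function $\psi:[0,\infty)^k\to\mathbb{R}$ is a Bernstein function of order $k$ in $(0,\infty)^k$ if it is $C^\infty$ on $(0,\infty)^k$ and $h=\partial_1\cdots\partial_k\psi$ satisfies $(-1)^{|\alpha|}\partial^\alpha h\ge0$ on $(0,\infty)^k$ for all $\alpha\in\mathbb{Z}_+^k$. Interactions. For a discrete probability $P$ in $\prod_{i=1}^nX_i$, $P_F$ is its marginal on $\prod_{i\in F}X_i$, $P_i=P_{\{i\}}$, and products of marginals are taken with coordinates in their original positions. The generalized Lancaster interaction is $\Lambda_k^n[P]=P+\sum_{j=0}^{k-1}(-1)^{k-j}\binom{n-j-1}{n-k}\sum_{|F|=j}P_F\times\big[\mathop{\times}_{i\in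 F^c}P_i\big]$. The Streitberg interaction is $\Sigma[P]=\sum_\pi(-1)^{|\pi|-1}(|\pi|-1)!\,P_\pi$, the sum over all partitions $\pi=\{F_1,\dots,F_\ell\}$ of $\{1,\dots,n\}$ into nonempty blocks, $|\pi|=\ell$, $P_\pi=\mathop{\times}_{i=1}^\ell P_{F_i}$. *)

theory Defs
  imports "HOL-Analysis.Analysis" "HOL-Library.Disjoint_Sets"
begin

text \<open>
  Points of a product over a finite index set \<open>I\<close> are extensional functions, i.e. elements of
  \<open>Pi\<^sub>E I X\<close>. On \<open>Pi\<^sub>E I (\<lambda>_. UNIV)\<close> the product topology of the function type is the Euclidean
  topology, and \<open>\<Pi>\<^sub>M i\<in>I. borel\<close> is its Borel sigma algebra. Functions on a subset of
  \<open>\<real>\<^sup>I\<close> are total functions whose values off that subset are never used.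
\<close>

definition orthant :: "nat set \<Rightarrow> (nat \<Rightarrow> real) set" where
  "orthant I = (\<Pi>\<^sub>E i\<in>I. {0..})"

definition open_orthant :: "nat set \<Rightarrow> (nat \<Rightarrow> real) set" where
  "open_orthant I = (\<Pi>\<^sub>E i\<in>I. {0<..})"

text \<open>
  \<open>bdry k {1..n}\<close> is \<open>\<partial>\<^sub>k\<^sub>-\<^sub>1\<^sup>n\<close>; the index is shifted by one so that it is never negative.
\<close>

definition bdry :: "nat \<Rightarrow> nat set \<Rightarrow> (nat \<Rightarrow> real) set" where
  "bdry k I = {r \<in> orthant I. card {i \<in> I. r i > 0} < k}"


subsection \<open>Discrete measures\<close>

text \<open>
  The discrete measure \<open>\<Sum>\<^sub>x c\<^sub>x \<delta>\<^sub>x\<close> is represented by its coefficient function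
  \<open>x \<mapsto> c\<^sub>x\<close>, which has finite support and determines the measure (and is determined by it, since
  \<open>c\<^sub>x\<close> is the mass of \<open>{x}\<close>). In particular the zero measure is \<open>\<lambda>_. 0\<close>.
\<close>

definition discrete_measure :: "'a set \<Rightarrow> ('a \<Rightarrow> real) \<Rightarrow> bool" where
  "discrete_measure S \<mu> \<longleftrightarrow> finite {x. \<mu> x \<noteq> 0} \<and> {x. \<mu> x \<noteq> 0} \<subseteq> S"

definition dmass :: "('a \<Rightarrow> real) \<Rightarrow> 'a set \<Rightarrow> real" where
  "dmass \<mu> A = (\<Sum>x | \<mu> x \<noteq> 0 \<and> x \<in> A. \<mu> x)"

definition dint :: "('a \<Rightarrow> real) \<Rightarrow> ('a \<Rightarrow> real) \<Rightarrow> real" where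
  "dint \<mu> f = (\<Sum>x | \<mu> x \<noteq> 0. f x * \<mu> x)"

definition discrete_prob :: "'a set \<Rightarrow> ('a \<Rightarrow> real) \<Rightarrow> bool" where
  "discrete_prob S P \<longleftrightarrow> discrete_measure S P \<and> (\<forall>x. P x \<ge> 0) \<and> dmass P S = 1"

definition M_space :: "nat \<Rightarrow> nat \<Rightarrow> (nat \<Rightarrow> 'a set) \<Rightarrow> ((nat \<Rightarrow> 'a) \<Rightarrow> real) set" where
  "M_space k n X = {\<mu>. discrete_measure (Pi\<^sub>E {1..n} X) \<mu> \<and>
     (\<forall>A. (\<forall>i\<in>{1..n}. A i \<subseteq> X i) \<and> card {i \<in> {1..n}. A i = X i} \<ge> n - k + 1
        \<longrightarrow> dmass \<mu> (Pi\<^sub>E {1..n} A) = 0)}"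


subsection \<open>PDI and SPDI functions\<close>

definition Rd :: "nat \<Rightarrow> (nat \<Rightarrow> real) set" where
  "Rd d = (\<Pi>\<^sub>E j\<in>{1..d}. UNIV)"

definition sqdists :: "nat \<Rightarrow> nat \<Rightarrow> (nat \<Rightarrow> nat \<Rightarrow> real) \<Rightarrow> (nat \<Rightarrow> nat \<Rightarrow> real) \<Rightarrow> nat \<Rightarrow> real" where
  "sqdists n d u v = (\<lambda>i\<in>{1..n}. (L2_set (\<lambda>j. u i j - v i j) {1..d})\<^sup>2)"

definition PDI :: "nat \<Rightarrow> nat \<Rightarrow> ((nat \<Rightarrow> real) \<Rightarrow> real) \<Rightarrow> bool" where
  "PDI k n g \<longleftrightarrow> (\<forall>d. \<forall>\<mu> \<in> M_space k n (\<lambda>_. Rd d).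
     dint \<mu> (\<lambda>v. dint \<mu> (\<lambda>u. (-1) ^ k * g (sqdists n d u v))) \<ge> 0)"

definition SPDI :: "nat \<Rightarrow> nat \<Rightarrow> ((nat \<Rightarrow> real) \<Rightarrow> real) \<Rightarrow> bool" where
  "SPDI k n g \<longleftrightarrow> PDI k n g \<and> (\<forall>d. \<forall>\<mu> \<in> M_space k n (\<lambda>_. Rd d).
     dint \<mu> (\<lambda>v. dint \<mu> (\<lambda>u. (-1) ^ k * g (sqdists n d u v))) = 0 \<longrightarrow> \<mu> = (\<lambda>_. 0))"


subsection \<open>Bernstein functions of several variables\<close>

definition partial :: "nat \<Rightarrow> ((nat \<Rightarrow> real) \<Rightarrow> real) \<Rightarrow> (nat \<Rightarrow> real) \<Rightarrow> real" where
  "partial i f = (\<lambda>x. deriv (\<lambda>s. f (x(i := s))) (x i))"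

text \<open>All iterated partial derivatives exist and are continuous on the open orthant.\<close>

definition smooth_orthant :: "nat set \<Rightarrow> ((nat \<Rightarrow> real) \<Rightarrow> real) \<Rightarrow> bool" where
  "smooth_orthant I f \<longleftrightarrow> (\<forall>is \<in> lists I.
     continuous_on (open_orthant I) (foldr partial is f) \<and>
     (\<forall>x \<in> open_orthant I. \<forall>i \<in> I.
        (\<lambda>s. foldr partial is f (x(i := s))) field_differentiable at (x i)))"

definition multi_partial ::
  "nat set \<Rightarrow> (nat \<Rightarrow> nat) \<Rightarrow> ((nat \<Rightarrow> real) \<Rightarrow> real) \<Rightarrow> (nat \<Rightarrow> real) \<Rightarrow> real" where
  "multi_partial I \<alpha> f = foldr (\<lambda>i. partial i ^^ \<alpha> i) (sorted_list_of_set I) f"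

text \<open>The order of the Bernstein function is \<open>card I\<close>; the variables are labelled by \<open>I\<close>.\<close>

definition bernstein :: "nat set \<Rightarrow> ((nat \<Rightarrow> real) \<Rightarrow> real) \<Rightarrow> bool" where
  "bernstein I \<psi> \<longleftrightarrow> smooth_orthant I \<psi> \<and>
     (\<forall>\<alpha>. \<forall>x \<in> open_orthant I.
        (-1) ^ (\<Sum>i\<in>I. \<alpha> i) * multi_partial I \<alpha> (multi_partial I (\<lambda>_. 1) \<psi>) x \<ge> 0)"


subsection \<open>The integral representation\<close>

definition esym :: "nat \<Rightarrow> nat \<Rightarrow> (nat \<Rightarrow> real) \<Rightarrow> real" where
  "esym k n r = (\<Sum>S | S \<subseteq> {1..n} \<and> card S = k. \<Prod>i\<in>S. r i)"

definition H_fun :: "nat \<Rightarrow> nat \<Rightarrow> (nat \<Rightarrow> real) \<Rightarrow> real" where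
  "H_fun k n r = esym n n r +
     (\<Sum>j<k. (-1) ^ (k - j) * real ((n - j - 1) choose (n - k)) * esym j n r)"

definition E_fun :: "nat \<Rightarrow> nat \<Rightarrow> (nat \<Rightarrow> real) \<Rightarrow> real" where
  "E_fun k n s = H_fun k n (\<lambda>i. exp (- s i))"

definition finite_borel_measure_on :: "nat \<Rightarrow> (nat \<Rightarrow> real) set \<Rightarrow> (nat \<Rightarrow> real) measure \<Rightarrow> bool" where
  "finite_borel_measure_on n A \<eta> \<longleftrightarrow>
     sets \<eta> = sets (restrict_space (\<Pi>\<^sub>M i\<in>{1..n}. borel) A) \<and> finite_measure \<eta>"

definition represents_zero :: "nat \<Rightarrow> ((nat \<Rightarrow> real) \<Rightarrow> real) \<Rightarrow> (nat \<Rightarrow> real) measure \<Rightarrow> bool" where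
  "represents_zero n g \<eta> \<longleftrightarrow>
     finite_borel_measure_on n (orthant {1..n}) \<eta> \<and>
     (\<forall>t \<in> orthant {1..n}.
        integrable \<eta> (\<lambda>r. exp (- (\<Sum>i=1..n. r i * t i))) \<and>
        g t = (\<integral>r. exp (- (\<Sum>i=1..n. r i * t i)) \<partial>\<eta>))"

definition bern_factor :: "real \<Rightarrow> real \<Rightarrow> real" where
  "bern_factor r t = (if r = 0 then t else (1 - exp (- (r * t))) * ((1 + r) / r))"

definition represents_full :: "nat \<Rightarrow> ((nat \<Rightarrow> real) \<Rightarrow> real) \<Rightarrow> (nat \<Rightarrow> real) measure \<Rightarrow> bool" where
  "represents_full n g \<eta> \<longleftrightarrow>
     finite_borel_measure_on n (orthant {1..n}) \<eta> \<and>
     (\<forall>t \<in> orthant {1..n}.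
        integrable \<eta> (\<lambda>r. \<Prod>i=1..n. bern_factor (r i) (t i)) \<and>
        g t = (\<integral>r. (\<Prod>i=1..n. bern_factor (r i) (t i)) \<partial>\<eta>))"

definition mid_kernel :: "nat \<Rightarrow> nat \<Rightarrow> (nat \<Rightarrow> real) \<Rightarrow> (nat \<Rightarrow> real) \<Rightarrow> real" where
  "mid_kernel k n t r =
     (-1) ^ k * E_fun k n (\<lambda>i. r i * t i) * (esym k n (\<lambda>i. r i + 1) / esym k n r)"

text \<open>\<open>\<psi> F\<close> is a function on \<open>[0,\<infinity>)\<^sup>F\<close>, with \<open>F\<close> in place of \<open>{1..k}\<close>.\<close>

definition represents_mid ::
  "nat \<Rightarrow> nat \<Rightarrow> ((nat \<Rightarrow> real) \<Rightarrow> real) \<Rightarrow> (nat \<Rightarrow> real) measure \<Rightarrow> bool" where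
  "represents_mid k n g \<eta> \<longleftrightarrow>
     finite_borel_measure_on n (orthant {1..n} - bdry (k + 1) {1..n}) \<eta> \<and>
     (\<exists>\<psi> :: nat set \<Rightarrow> (nat \<Rightarrow> real) \<Rightarrow> real.
        (\<forall>F. F \<subseteq> {1..n} \<and> card F = k \<longrightarrow>
           continuous_on (orthant F) (\<psi> F) \<and> bernstein F (\<psi> F) \<and> (\<forall>t \<in> bdry k F. \<psi> F t = 0)) \<and>
        (\<forall>t \<in> orthant {1..n}.
           integrable \<eta> (mid_kernel k n t) \<and>
           g t = (\<Sum>F | F \<subseteq> {1..n} \<and> card F = k. \<psi> F (restrict t F))
               + (\<integral>r. mid_kernel k n t r \<partial>\<eta>)))"

definition representing_measure ::
  "nat \<Rightarrow> nat \<Rightarrow> ((nat \<Rightarrow> real) \<Rightarrow> real) \<Rightarrow> (nat \<Rightarrow> real) measure \<Rightarrow> bool" where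
  "representing_measure k n g \<eta> \<longleftrightarrow>
     (if k = 0 then represents_zero n g \<eta>
      else if k = n then represents_full n g \<eta>
      else represents_mid k n g \<eta>)"


subsection \<open>Interactions\<close>

definition marginal :: "nat set \<Rightarrow> ((nat \<Rightarrow> 'a) \<Rightarrow> real) \<Rightarrow> (nat \<Rightarrow> 'a) \<Rightarrow> real" where
  "marginal F P y = dmass P {x. restrict x F = y}"

text \<open>
  The product of the marginals \<open>P\<^sub>B\<close> over the disjoint blocks \<open>B \<in> \<BB>\<close>, as a measure on the product
  over \<open>\<Union>\<BB>\<close>. A product of discrete measures has the products of the coefficients as
  coefficients; the guard removes functions that are not points of the product space.
\<close>

definition block_product :: "nat set set \<Rightarrow> ((nat \<Rightarrow> 'a) \<Rightarrow> real) \<Rightarrow> (nat \<Rightarrow> 'a) \<Rightarrow> real" where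
  "block_product \<BB> P x =
     (if x \<in> extensional (\<Union>\<BB>) then \<Prod>B\<in>\<BB>. marginal B P (restrict x B) else 0)"

text \<open>For \<open>F = {}\<close>, the factor \<open>P\<^sub>F\<close> is the unit mass on the one-point space \<open>Pi\<^sub>E {} X\<close>.\<close>

definition lancaster :: "nat \<Rightarrow> nat \<Rightarrow> ((nat \<Rightarrow> 'a) \<Rightarrow> real) \<Rightarrow> (nat \<Rightarrow> 'a) \<Rightarrow> real" where
  "lancaster k n P x = P x +
     (\<Sum>j<k. (-1) ^ (k - j) * real ((n - j - 1) choose (n - k)) *
        (\<Sum>F | F \<subseteq> {1..n} \<and> card F = j.
           block_product (insert F ((\<lambda>i. {i}) ` ({1..n} - F))) P x))"

definition streitberg :: "nat \<Rightarrow> ((nat \<Rightarrow> 'a) \<Rightarrow> real) \<Rightarrow> (nat \<Rightarrow> 'a) \<Rightarrow> real" where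
  "streitberg n P x =
     (\<Sum>\<pi> | partition_on {1..n} \<pi>.
        (-1) ^ (card \<pi> - 1) * fact (card \<pi> - 1) * block_product \<pi> P x)"

text \<open>
  Both interactions are again discrete measures in the product, so that \<open>dint\<close> over them is a sum
  over a finite support.
\<close>

lemma discrete_measure_add:
  assumes "discrete_measure S \<mu>" "discrete_measure S \<nu>"
  shows "discrete_measure S (\<lambda>x. \<mu> x + \<nu> x)"
proof -
  have "{x. \<mu> x + \<nu> x \<noteq> 0} \<subseteq> {x. \<mu> x \<noteq> 0} \<union> {x. \<nu> x \<noteq> 0}" by auto
  moreover have "finite ({x. \<mu> x \<noteq> 0} \<union> {x. \<nu> x \<noteq> 0})" "{x. \<mu> x \<noteq> 0} \<union> {x. \<nu> x \<noteq> 0} \<subseteq> S"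
    using assms by (simp_all add: discrete_measure_def)
  ultimately show ?thesis
    unfolding discrete_measure_def by (blast intro: finite_subset)
qed

lemma discrete_measure_scale:
  assumes "discrete_measure S \<mu>"
  shows "discrete_measure S (\<lambda>x. c * \<mu> x)"
  using assms unfolding discrete_measure_def by (auto intro: rev_finite_subset)

lemma discrete_measure_sum:
  assumes "\<And>a. a \<in> A \<Longrightarrow> discrete_measure S (\<mu> a)"
  shows "discrete_measure S (\<lambda>x. \<Sum>a\<in>A. \<mu> a x)"
  using assms
proof (induction A rule: infinite_finite_induct)
  case (insert a A)
  then show ?case by (simp add: discrete_measure_add)
qed (simp_all add: discrete_measure_def)

lemma discrete_measure_block_product:
  assumes P: "discrete_measure (Pi\<^sub>E I X) P" and B: "\<Union>\<BB> = I" "finite I"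
  shows "discrete_measure (Pi\<^sub>E I X) (block_product \<BB> P)"
proof -
  define S where "S = {x. P x \<noteq> 0}"
  have S: "finite S" "S \<subseteq> Pi\<^sub>E I X"
    using P by (auto simp: S_def discrete_measure_def)
  have fB: "finite \<BB>"
    using B by (metis finite_UnionD)
  have key: "x \<in> (\<Pi>\<^sub>E i\<in>I. (\<lambda>y. y i) ` S)" if nz: "block_product \<BB> P x \<noteq> 0" for x
  proof (rule PiE_I)
    fix i assume "i \<in> I"
    then obtain C where C: "C \<in> \<BB>" "i \<in> C" using B by auto
    have "marginal C P (restrict x C) \<noteq> 0"
      using nz fB C by (auto simp: block_product_def split: if_splits)
    then obtain y where "y \<in> S" "restrict y C = restrict x C"
      unfolding marginal_def dmass_def S_def by (auto elim!: sum.not_neutral_contains_not_neutral)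
    then show "x i \<in> (\<lambda>y. y i) ` S"
      using C by (metis image_eqI restrict_apply')
  next
    fix i assume "i \<notin> I"
    then show "x i = undefined"
      using nz B by (auto simp: block_product_def extensional_def split: if_splits)
  qed
  have fin: "finite (\<Pi>\<^sub>E i\<in>I. (\<lambda>y. y i) ` S)"
    using S B by (intro finite_PiE) auto
  have sub: "(\<Pi>\<^sub>E i\<in>I. (\<lambda>y. y i) ` S) \<subseteq> Pi\<^sub>E I X"
    using S by (intro PiE_mono) (auto simp: PiE_iff)
  have supp: "{x. block_product \<BB> P x \<noteq> 0} \<subseteq> (\<Pi>\<^sub>E i\<in>I. (\<lambda>y. y i) ` S)"
    using key by blast
  show ?thesis
    unfolding discrete_measure_def
    using finite_subset[OF supp fin] order_trans[OF supp sub] by (rule conjI)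
qed

lemma discrete_measure_lancaster:
  assumes P: "discrete_measure (Pi\<^sub>E {1..n} X) P"
  shows "discrete_measure (Pi\<^sub>E {1..n} X) (lancaster k n P)"
  unfolding lancaster_def
  by (intro discrete_measure_add discrete_measure_sum discrete_measure_scale
      discrete_measure_block_product P) auto

lemma discrete_measure_streitberg:
  assumes P: "discrete_measure (Pi\<^sub>E {1..n} X) P"
  shows "discrete_measure (Pi\<^sub>E {1..n} X) (streitberg n P)"
  unfolding streitberg_def
  by (intro discrete_measure_sum discrete_measure_scale discrete_measure_block_product P)
    (auto dest: partition_onD1)

end

theory Submission
  imports Defs
begin

text \<open>
  On a measure in \<open>M_space k n X\<close> every function of fewer than \<open>k\<close> coordinates integrates to zero. In
  the expansion of the kernels of the integral representation all terms but
  \<open>exp (- (\<Sum>i. r i * t i))\<close> are of this kind, so that the form of \<open>g\<close> is an integral over \<open>\<eta>\<close> of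
  positive multiples of Gaussian forms and limits of these, plus the forms of the Bernstein terms
  when \<open>0 < k < n\<close>.

  The Gaussian form is positive definite, strictly so when all \<open>r i\<close> are positive
  (\<open>gauss_qform_nonneg\<close>, \<open>gauss_qform_pos\<close>). The forms of the Bernstein terms are nonnegative
  (\<open>bernstein_term_nonneg\<close>): \<open>\<psi> F\<close> is isolated by testing the hypothesis on \<open>g\<close> with measures whose
  coordinates outside \<open>F\<close> are independent of the others and spread over far apart points. So a charge
  of \<open>\<eta>\<close> on the open orthant makes \<open>g\<close> strict. If there is no such charge, the tensor power of a
  second difference on the line is a nonzero measure on which the form vanishes, because each
  parameter that matters has a zero coordinate, whose factor of the kernel is \<open>1\<close> or
  \<open>|u i - v i|\<^sup>2\<close> and is annihilated by the second difference (\<open>strictness_dichotomy\<close>).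

  For the tests by interactions, \<open>lancaster k n P\<close> and \<open>streitberg n P\<close> have vanishing marginals of the
  required orders (\<open>lancaster_M_space\<close>, \<open>streitberg_M_space\<close>), hence strictness implies the
  equivalences. Conversely the law of independent uniform variables, perturbed by the above tensor
  power, has the marginals of the unperturbed law, so that both of its interactions reduce to the
  perturbation (\<open>lancaster_perturbed_uniform\<close>, \<open>streitberg_perturbed_uniform\<close>). If \<open>g\<close> is not strict,
  this law violates the equivalences.
\<close>

section \<open>Integration against discrete measures\<close>

lemma dint_superset:
  assumes "finite T" "{x. \<mu> x \<noteq> 0} \<subseteq> T"
  shows "dint \<mu> f = (\<Sum>x\<in>T. f x * \<mu> x)"
  unfolding dint_def using assms by (intro sum.mono_neutral_left) auto

lemma dint_cong: "(\<And>x. \<mu> x \<noteq> 0 \<Longrightarrow> f x = f' x) \<Longrightarrow> dint \<mu> f = dint \<mu> f'"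
  unfolding dint_def by (auto intro: sum.cong)

lemma dint_sum: "dint \<mu> (\<lambda>x. \<Sum>a\<in>I. f a x) = (\<Sum>a\<in>I. dint \<mu> (f a))"
  unfolding dint_def sum_distrib_right by (rule sum.swap)

lemma dint_mult: "dint \<mu> (\<lambda>x. c * f x) = c * dint \<mu> f"
  by (simp add: dint_def sum_distrib_left mult.assoc)

lemma dint_add: "dint \<mu> (\<lambda>x. f x + f' x) = dint \<mu> f + dint \<mu> f'"
  by (simp add: dint_def distrib_right sum.distrib)

lemma dint_measure_add:
  assumes "discrete_measure S \<mu>" "discrete_measure S' \<nu>"
  shows "dint (\<lambda>x. \<mu> x + \<nu> x) f = dint \<mu> f + dint \<nu> f"
proof -
  define T where "T = {x. \<mu> x \<noteq> 0} \<union> {x. \<nu> x \<noteq> 0}"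
  have "finite T" using assms by (simp add: T_def discrete_measure_def)
  then have "dint (\<lambda>x. \<mu> x + \<nu> x) f = (\<Sum>x\<in>T. f x * (\<mu> x + \<nu> x))"
    "dint \<mu> f = (\<Sum>x\<in>T. f x * \<mu> x)" "dint \<nu> f = (\<Sum>x\<in>T. f x * \<nu> x)"
    by (auto intro!: dint_superset simp: T_def)
  then show ?thesis by (simp add: distrib_left sum.distrib)
qed

lemma dint_measure_scale: "dint (\<lambda>x. c * \<mu> x) f = c * dint \<mu> f"
  by (cases "c = 0") (simp_all add: dint_def sum_distrib_left mult_ac)

lemma dint_measure_sum:
  assumes "\<And>a. a \<in> I \<Longrightarrow> discrete_measure S (\<mu> a)"
  shows "dint (\<lambda>x. \<Sum>a\<in>I. \<mu> a x) f = (\<Sum>a\<in>I. dint (\<mu> a) f)"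
  using assms
proof (induction I rule: infinite_finite_induct)
  case (insert a I)
  have "discrete_measure S (\<lambda>x. \<Sum>a\<in>I. \<mu> a x)"
    by (rule discrete_measure_sum) (use insert in auto)
  then show ?case using insert by (simp add: dint_measure_add[of S _ S])
qed (simp_all add: dint_def)

text \<open>
  The points of the family may repeat, which lets images of measures be written without
  describing fibres; block products and the spread measures below are integrated in this form.
\<close>

definition point_masses :: "'b set \<Rightarrow> ('b \<Rightarrow> real) \<Rightarrow> ('b \<Rightarrow> 'a) \<Rightarrow> 'a \<Rightarrow> real" where
  "point_masses A c p = (\<lambda>x. \<Sum>a | a \<in> A \<and> p a = x. c a)"

lemma support_point_masses: "{x. point_masses A c p x \<noteq> 0} \<subseteq> p ` A"
  unfolding point_masses_def by (auto elim!: sum.not_neutral_contains_not_neutral)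

lemma discrete_measure_point_masses:
  assumes "finite A" "\<And>a. a \<in> A \<Longrightarrow> p a \<in> S"
  shows "discrete_measure S (point_masses A c p)"
  unfolding discrete_measure_def using assms support_point_masses[of A c p]
  by (auto intro: finite_subset)

lemma dint_point_masses:
  assumes "finite A"
  shows "dint (point_masses A c p) f = (\<Sum>a\<in>A. f (p a) * c a)"
proof -
  have "dint (point_masses A c p) f = (\<Sum>x\<in>p ` A. f x * point_masses A c p x)"
    using assms by (intro dint_superset support_point_masses) auto
  also have "\<dots> = (\<Sum>x\<in>p ` A. \<Sum>a | a \<in> A \<and> p a = x. f (p a) * c a)"
    unfolding point_masses_def sum_distrib_left by (intro sum.cong) auto
  also have "\<dots> = (\<Sum>a\<in>A. f (p a) * c a)"
    using assms by (intro sum.image_gen[symmetric])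
  finally show ?thesis .
qed

definition qform :: "('a \<Rightarrow> real) \<Rightarrow> ('a \<Rightarrow> 'a \<Rightarrow> real) \<Rightarrow> real" where
  "qform \<mu> h = dint \<mu> (\<lambda>v. dint \<mu> (\<lambda>u. h u v))"

lemma qform_cong:
  "(\<And>u v. \<mu> u \<noteq> 0 \<Longrightarrow> \<mu> v \<noteq> 0 \<Longrightarrow> h u v = h' u v) \<Longrightarrow> qform \<mu> h = qform \<mu> h'"
  unfolding qform_def by (auto intro!: dint_cong)

lemma qform_sum: "qform \<mu> (\<lambda>u v. \<Sum>a\<in>I. h a u v) = (\<Sum>a\<in>I. qform \<mu> (h a))"
  by (simp add: qform_def dint_sum)

lemma qform_mult: "qform \<mu> (\<lambda>u v. c * h u v) = c * qform \<mu> h"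
  by (simp add: qform_def dint_mult)

lemma qform_add: "qform \<mu> (\<lambda>u v. h u v + h' u v) = qform \<mu> h + qform \<mu> h'"
  by (simp add: qform_def dint_add)

lemma qform_eq_sum:
  "qform \<mu> h = (\<Sum>u | \<mu> u \<noteq> 0. \<Sum>v | \<mu> v \<noteq> 0. \<mu> u * \<mu> v * h u v)"
  unfolding qform_def dint_def sum_distrib_right
  by (rule trans[OF sum.swap]) (simp add: mult_ac)

lemma
  assumes "\<And>u v. \<mu> u \<noteq> 0 \<Longrightarrow> \<mu> v \<noteq> 0 \<Longrightarrow> integrable \<eta> (h u v)"
  shows integrable_qform: "integrable \<eta> (\<lambda>r. qform \<mu> (\<lambda>u v. h u v r))"
    and integral_qform: "(\<integral>r. qform \<mu> (\<lambda>u v. h u v r) \<partial>\<eta>) = qform \<mu> (\<lambda>u v. \<integral>r. h u v r \<partial>\<eta>)"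
proof -
  have int: "integrable \<eta> (\<lambda>r. \<mu> u * \<mu> v * h u v r)" if "u \<in> {u. \<mu> u \<noteq> 0}" "v \<in> {v. \<mu> v \<noteq> 0}" for u v
    using assms that by simp
  have int2: "integrable \<eta> (\<lambda>r. \<Sum>v | \<mu> v \<noteq> 0. \<mu> u * \<mu> v * h u v r)" if "u \<in> {u. \<mu> u \<noteq> 0}" for u
    by (rule Bochner_Integration.integrable_sum, rule int[OF that])
  then show "integrable \<eta> (\<lambda>r. qform \<mu> (\<lambda>u v. h u v r))"
    unfolding qform_eq_sum by (rule Bochner_Integration.integrable_sum)
  have "(\<integral>r. (\<Sum>u | \<mu> u \<noteq> 0. \<Sum>v | \<mu> v \<noteq> 0. \<mu> u * \<mu> v * h u v r) \<partial>\<eta>)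
      = (\<Sum>u | \<mu> u \<noteq> 0. \<integral>r. (\<Sum>v | \<mu> v \<noteq> 0. \<mu> u * \<mu> v * h u v r) \<partial>\<eta>)"
    by (rule Bochner_Integration.integral_sum[OF int2])
  also have "\<dots> = (\<Sum>u | \<mu> u \<noteq> 0. \<Sum>v | \<mu> v \<noteq> 0. \<integral>r. \<mu> u * \<mu> v * h u v r \<partial>\<eta>)"
    by (rule sum.cong[OF refl], rule Bochner_Integration.integral_sum[OF int])
  finally show "(\<integral>r. qform \<mu> (\<lambda>u v. h u v r) \<partial>\<eta>) = qform \<mu> (\<lambda>u v. \<integral>r. h u v r \<partial>\<eta>)"
    by (simp add: qform_eq_sum)
qed

lemma tendsto_qform:
  assumes "\<And>u v. \<mu> u \<noteq> 0 \<Longrightarrow> \<mu> v \<noteq> 0 \<Longrightarrow> ((\<lambda>s. h s u v) \<longlongrightarrow> l u v) F"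
  shows "((\<lambda>s. qform \<mu> (h s)) \<longlongrightarrow> qform \<mu> l) F"
  unfolding qform_eq_sum using assms by (auto intro!: tendsto_sum tendsto_mult_left)


section \<open>Measures with vanishing marginals\<close>

lemma prod_of_bool:
  "finite I \<Longrightarrow> (\<Prod>i\<in>I. of_bool (Q i) :: real) = of_bool (\<forall>i\<in>I. Q i)"
  by (induction I rule: finite_induct) auto

lemma dmass_eq_dint:
  assumes "finite {x. \<mu> x \<noteq> 0}"
  shows "dmass \<mu> A = dint \<mu> (\<lambda>x. of_bool (x \<in> A))"
proof -
  have "{x. \<mu> x \<noteq> 0 \<and> x \<in> A} = {x. \<mu> x \<noteq> 0} \<inter> A" by auto
  then show ?thesis
    unfolding dmass_def dint_def using assms
    by (simp add: of_bool_def if_distrib[of "\<lambda>z. z * _"] sum.If_cases cong: if_cong)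
qed

text \<open>
  The rectangles in the definition of \<open>M_space\<close> may be replaced by cylinders over fewer than \<open>k\<close>
  coordinates, whose indicators are products and thus factor over the blocks of a partition.
\<close>

lemma M_spaceI:
  assumes \<mu>: "discrete_measure (Pi\<^sub>E {1..n} X) \<mu>" and "k \<le> n"
    and null: "\<And>G A. G \<subseteq> {1..n} \<Longrightarrow> card G < k \<Longrightarrow>
      dint \<mu> (\<lambda>x. \<Prod>i\<in>G. of_bool (x i \<in> A i)) = 0"
  shows "\<mu> \<in> M_space k n X"
  unfolding M_space_def
proof (intro CollectI conjI allI impI \<mu>; elim conjE)
  fix A assume A: "\<forall>i\<in>{1..n}. A i \<subseteq> X i" and c: "n - k + 1 \<le> card {i \<in> {1..n}. A i = X i}"
  define G where "G = {1..n} - {i \<in> {1..n}. A i = X i}"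
  have "card G = n - card {i \<in> {1..n}. A i = X i}"
    unfolding G_def by (subst card_Diff_subset) auto
  moreover have "card {i \<in> {1..n}. A i = X i} \<le> n"
    using card_mono[of "{1..n}" "{i \<in> {1..n}. A i = X i}"] by fastforce
  ultimately have "card G < k" using c \<open>k \<le> n\<close> by linarith
  then have "dint \<mu> (\<lambda>x. \<Prod>i\<in>G. of_bool (x i \<in> A i)) = 0"
    by (intro null) (auto simp: G_def)
  moreover have "dint \<mu> (\<lambda>x. of_bool (x \<in> Pi\<^sub>E {1..n} A))
      = dint \<mu> (\<lambda>x. \<Prod>i\<in>G. of_bool (x i \<in> A i))"
  proof (rule dint_cong)
    fix x assume "\<mu> x \<noteq> 0"
    then have x: "x \<in> Pi\<^sub>E {1..n} X" using \<mu> by (auto simp: discrete_measure_def)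
    have "finite G" by (simp add: G_def)
    have "x \<in> Pi\<^sub>E {1..n} A \<longleftrightarrow> (\<forall>i\<in>G. x i \<in> A i)"
    proof
      assume *: "\<forall>i\<in>G. x i \<in> A i"
      have "x i \<in> A i" if "i \<in> {1..n}" for i
        using * x that by (cases "i \<in> G") (auto simp: G_def PiE_iff)
      then show "x \<in> Pi\<^sub>E {1..n} A" using x by (auto simp: PiE_iff)
    qed (auto simp: G_def PiE_iff)
    then show "of_bool (x \<in> Pi\<^sub>E {1..n} A) = (\<Prod>i\<in>G. of_bool (x i \<in> A i) :: real)"
      using \<open>finite G\<close> by (simp add: prod_of_bool)
  qed
  ultimately show "dmass \<mu> (Pi\<^sub>E {1..n} A) = 0"
    using \<mu> by (simp add: dmass_eq_dint discrete_measure_def)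
qed

lemma M_space_discrete: "\<mu> \<in> M_space k n X \<Longrightarrow> discrete_measure (Pi\<^sub>E {1..n} X) \<mu>"
  by (simp add: M_space_def)

text \<open>
  Sorting the atoms by their coordinates in \<open>G\<close> groups the integral into masses of cylinders,
  all of which vanish.
\<close>

lemma dint_M_space_eq_0:
  assumes \<mu>: "\<mu> \<in> M_space k n X" and G: "G \<subseteq> {1..n}" "card G < k" and "k \<le> n"
    and dep: "\<And>x y. x \<in> Pi\<^sub>E {1..n} X \<Longrightarrow> y \<in> Pi\<^sub>E {1..n} X \<Longrightarrow> \<forall>i\<in>G. x i = y i \<Longrightarrow> f x = f y"
  shows "dint \<mu> f = 0"
proof -
  define T where "T = {x. \<mu> x \<noteq> 0}"
  have T: "finite T" "T \<subseteq> Pi\<^sub>E {1..n} X"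
    using M_space_discrete[OF \<mu>] by (auto simp: T_def discrete_measure_def)
  have cyl: "(\<Sum>x | x \<in> T \<and> restrict x G = restrict y G. f x * \<mu> x) = 0" if y: "y \<in> T" for y
  proof -
    define A where "A i = (if i \<in> G then {y i} else X i)" for i
    have yX: "y \<in> Pi\<^sub>E {1..n} X" using y T by auto
    have "n - card G = card ({1..n} - G)"
      using G by (subst card_Diff_subset) (auto intro: finite_subset)
    also have "\<dots> \<le> card {i \<in> {1..n}. A i = X i}"
      by (intro card_mono) (auto simp: A_def)
    finally have "n - k + 1 \<le> card {i \<in> {1..n}. A i = X i}"
      using G \<open>k \<le> n\<close> by linarith
    moreover have "\<forall>i\<in>{1..n}. A i \<subseteq> X i"
      using yX G by (auto simp: A_def PiE_iff)
    ultimately have "dmass \<mu> (Pi\<^sub>E {1..n} A) = 0"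
      using \<mu> by (auto simp: M_space_def)
    moreover have "x \<in> Pi\<^sub>E {1..n} A \<longleftrightarrow> restrict x G = restrict y G" if "x \<in> T" for x
    proof
      assume "x \<in> Pi\<^sub>E {1..n} A"
      then have "x i = y i" if "i \<in> G" for i
        using that G by (force simp: A_def PiE_iff)
      then show "restrict x G = restrict y G" by (rule restrict_ext)
    next
      assume eq: "restrict x G = restrict y G"
      have "x i \<in> A i" if "i \<in> {1..n}" for i
        using fun_cong[OF eq, of i] \<open>x \<in> T\<close> T(2) that by (auto simp: A_def PiE_iff)
      then show "x \<in> Pi\<^sub>E {1..n} A" using \<open>x \<in> T\<close> T(2) by (auto simp: PiE_iff)
    qed
    then have "{x. \<mu> x \<noteq> 0 \<and> x \<in> Pi\<^sub>E {1..n} A} = {x. x \<in> T \<and> restrict x G = restrict y G}"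
      by (auto simp: T_def)
    moreover have "(\<Sum>x | x \<in> T \<and> restrict x G = restrict y G. f x * \<mu> x)
        = (\<Sum>x | x \<in> T \<and> restrict x G = restrict y G. f y * \<mu> x)"
    proof (rule sum.cong[OF refl])
      fix x assume "x \<in> {x. x \<in> T \<and> restrict x G = restrict y G}"
      then have "x \<in> Pi\<^sub>E {1..n} X" "\<forall>i\<in>G. x i = y i"
        using T by (auto simp: restrict_def fun_eq_iff split: if_splits)
      then show "f x * \<mu> x = f y * \<mu> x" using dep[OF _ yX] by auto
    qed
    ultimately show ?thesis
      by (simp add: dmass_def sum_distrib_left[symmetric])
  qed
  have "dint \<mu> f = (\<Sum>z\<in>(\<lambda>x. restrict x G) ` T. \<Sum>x | x \<in> T \<and> restrict x G = z. f x * \<mu> x)"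
    unfolding dint_def T_def[symmetric] by (rule sum.image_gen[OF T(1)])
  also have "\<dots> = 0"
    using cyl by (intro sum.neutral) auto
  finally show ?thesis .
qed

lemma M_space_mono:
  assumes "\<mu> \<in> M_space m n X" "k \<le> m" "m \<le> n"
  shows "\<mu> \<in> M_space k n X"
proof (rule M_spaceI)
  fix G A assume G: "G \<subseteq> {1..n}" "card G < k"
  show "dint \<mu> (\<lambda>x. \<Prod>i\<in>G. of_bool (x i \<in> A i)) = 0"
    by (rule dint_M_space_eq_0[OF assms(1) G(1)]) (use G assms in \<open>auto intro!: prod.cong\<close>)
qed (use assms M_space_discrete in auto)

lemma qform_M_space_eq_0:
  assumes \<mu>: "\<mu> \<in> M_space k n X" and G: "G \<subseteq> {1..n}" "card G < k" and "k \<le> n"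
    and dep: "\<And>x y v. x \<in> Pi\<^sub>E {1..n} X \<Longrightarrow> y \<in> Pi\<^sub>E {1..n} X \<Longrightarrow> \<forall>i\<in>G. x i = y i \<Longrightarrow> h x v = h y v"
  shows "qform \<mu> h = 0"
  unfolding qform_def
proof -
  have "dint \<mu> (\<lambda>u. h u v) = 0" for v
    by (rule dint_M_space_eq_0[OF \<mu> G \<open>k \<le> n\<close>]) (rule dep)
  then show "dint \<mu> (\<lambda>v. dint \<mu> (\<lambda>u. h u v)) = 0" by (simp add: dint_def)
qed


section \<open>Strict positive definiteness of the Gaussian kernel\<close>

definition power_form :: "'a set \<Rightarrow> 'j set \<Rightarrow> ('a \<Rightarrow> 'j \<Rightarrow> real) \<Rightarrow> ('a \<Rightarrow> real) \<Rightarrow> nat \<Rightarrow> real" where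
  "power_form T J \<phi> a m = (\<Sum>u\<in>T. \<Sum>v\<in>T. a u * a v * (\<Sum>j\<in>J. \<phi> u j * \<phi> v j) ^ m)"

lemma power_form_0: "power_form T J \<phi> a 0 = (\<Sum>u\<in>T. a u)\<^sup>2"
  by (simp add: power_form_def power2_eq_square sum_product)

text \<open>
  Splitting one factor off the power of the inner product leaves forms of lower degree, in which
  the weights have been multiplied by a coordinate function.
\<close>

lemma power_form_Suc:
  "power_form T J \<phi> a (Suc m) = (\<Sum>j\<in>J. power_form T J \<phi> (\<lambda>u. a u * \<phi> u j) m)"
proof -
  have "power_form T J \<phi> a (Suc m)
      = (\<Sum>u\<in>T. \<Sum>v\<in>T. \<Sum>j\<in>J. a u * \<phi> u j * (a v * \<phi> v j) * (\<Sum>j\<in>J. \<phi> u j * \<phi> v j) ^ m)"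
    unfolding power_form_def
    by (intro sum.cong refl) (simp add: sum_distrib_left sum_distrib_right mult_ac)
  also have "\<dots> = (\<Sum>u\<in>T. \<Sum>j\<in>J. \<Sum>v\<in>T. a u * \<phi> u j * (a v * \<phi> v j) * (\<Sum>j\<in>J. \<phi> u j * \<phi> v j) ^ m)"
    by (intro sum.cong refl sum.swap)
  also have "\<dots> = (\<Sum>j\<in>J. power_form T J \<phi> (\<lambda>u. a u * \<phi> u j) m)"
    unfolding power_form_def by (rule sum.swap)
  finally show ?thesis .
qed

lemma power_form_nonneg: "0 \<le> power_form T J \<phi> a m"
  by (induction m arbitrary: a) (auto simp: power_form_0 power_form_Suc intro: sum_nonneg)

text \<open>
  The forms of lower degree are nonnegative, so that they vanish together with their sum.
\<close>

lemma power_form_null_monomial: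
  assumes "finite J" "\<And>m. power_form T J \<phi> a m = 0" "set w \<subseteq> J"
  shows "(\<Sum>u\<in>T. a u * (\<Prod>j\<leftarrow>w. \<phi> u j)) = 0"
  using assms(2,3)
proof (induction w arbitrary: a)
  case Nil
  then show ?case using Nil(1)[of 0] by (simp add: power_form_0)
next
  case (Cons j w)
  have "power_form T J \<phi> (\<lambda>u. a u * \<phi> u j) m = 0" for m
  proof -
    have "(\<Sum>j\<in>J. power_form T J \<phi> (\<lambda>u. a u * \<phi> u j) m) = 0"
      using Cons.prems(1)[of "Suc m"] by (simp add: power_form_Suc)
    then show ?thesis
      using Cons.prems(2) by (simp add: sum_nonneg_eq_0_iff assms(1) power_form_nonneg)
  qed
  from Cons.IH[OF this] Cons.prems(2) show ?case by (simp add: mult_ac)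
qed

text \<open>
  Weights orthogonal to all monomials vanish: the polynomial \<open>\<Prod>\<^sub>v \<langle>\<phi> x - \<phi> v, \<phi> u - \<phi> v\<rangle>\<close>, the
  product running over the points \<open>v\<close> other than \<open>u\<close>, isolates the point \<open>u\<close>.
\<close>

lemma monomial_null_weights:
  fixes a :: "'a \<Rightarrow> real" and \<phi> :: "'a \<Rightarrow> 'j \<Rightarrow> real"
  assumes T: "finite T" and J: "finite J" and u: "u \<in> T"
    and null: "\<And>w. set w \<subseteq> J \<Longrightarrow> (\<Sum>x\<in>T. a x * (\<Prod>j\<leftarrow>w. \<phi> x j)) = 0"
    and sep: "\<And>v. v \<in> T \<Longrightarrow> v \<noteq> u \<Longrightarrow> \<exists>j\<in>J. \<phi> u j \<noteq> \<phi> v j"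
  shows "a u = 0"
proof -
  define L where "L v x = (\<Sum>j\<in>J. (\<phi> x j - \<phi> v j) * (\<phi> u j - \<phi> v j))" for v x
  have "(\<Sum>x\<in>T. a x * (\<Prod>v\<in>V. L v x) * (\<Prod>j\<leftarrow>w. \<phi> x j)) = 0"
    if "finite V" "set w \<subseteq> J" for V w
    using that
  proof (induction V arbitrary: w rule: finite_induct)
    case empty
    then show ?case by (simp add: null)
  next
    case (insert v V)
    define b where "b x = a x * (\<Prod>v\<in>V. L v x)" for x
    have b: "(\<Sum>x\<in>T. b x * (\<Prod>j\<leftarrow>w. \<phi> x j)) = 0" if "set w \<subseteq> J" for w
      unfolding b_def using insert.IH[OF that] .
    have "(\<Sum>x\<in>T. a x * (\<Prod>v\<in>insert v V. L v x) * (\<Prod>j\<leftarrow>w. \<phi> x j))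
        = (\<Sum>x\<in>T. \<Sum>j\<in>J. (\<phi> u j - \<phi> v j) *
            (b x * (\<Prod>j\<leftarrow>j # w. \<phi> x j) - \<phi> v j * (b x * (\<Prod>j\<leftarrow>w. \<phi> x j))))"
    proof (rule sum.cong[OF refl])
      fix x
      have "a x * (\<Prod>v\<in>insert v V. L v x) * (\<Prod>j\<leftarrow>w. \<phi> x j) = L v x * (b x * (\<Prod>j\<leftarrow>w. \<phi> x j))"
        using insert.hyps by (simp add: b_def mult_ac)
      also have "\<dots> = (\<Sum>j\<in>J. (\<phi> u j - \<phi> v j) *
            (b x * (\<Prod>j\<leftarrow>j # w. \<phi> x j) - \<phi> v j * (b x * (\<Prod>j\<leftarrow>w. \<phi> x j))))"
        unfolding L_def sum_distrib_right by (intro sum.cong refl) (simp add: algebra_simps)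
      finally show "a x * (\<Prod>v\<in>insert v V. L v x) * (\<Prod>j\<leftarrow>w. \<phi> x j) = \<dots>" .
    qed
    also have "\<dots> = (\<Sum>j\<in>J. (\<phi> u j - \<phi> v j) * ((\<Sum>x\<in>T. b x * (\<Prod>j\<leftarrow>j # w. \<phi> x j))
        - \<phi> v j * (\<Sum>x\<in>T. b x * (\<Prod>j\<leftarrow>w. \<phi> x j))))"
      by (rule trans[OF sum.swap]) (simp only: sum_distrib_left sum_subtractf right_diff_distrib)
    also have "\<dots> = 0"
    proof (intro sum.neutral ballI)
      fix j assume "j \<in> J"
      then have "(\<Sum>x\<in>T. b x * (\<Prod>j\<leftarrow>j # w. \<phi> x j)) = 0" "(\<Sum>x\<in>T. b x * (\<Prod>j\<leftarrow>w. \<phi> x j)) = 0"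
        using insert.prems by (intro b; simp)+
      then show "(\<phi> u j - \<phi> v j) * ((\<Sum>x\<in>T. b x * (\<Prod>j\<leftarrow>j # w. \<phi> x j))
        - \<phi> v j * (\<Sum>x\<in>T. b x * (\<Prod>j\<leftarrow>w. \<phi> x j))) = 0" by (simp only:) simp
    qed
    finally show ?case .
  qed
  from this[of "T - {u}" "[]"] T have "(\<Sum>x\<in>T. a x * (\<Prod>v\<in>T - {u}. L v x)) = 0" by simp
  moreover have "(\<Prod>v\<in>T - {u}. L v x) = 0" if "x \<in> T" "x \<noteq> u" for x
    using that T by (intro prod_zero bexI[of _ x]) (auto simp: L_def)
  then have "(\<Sum>x\<in>T. a x * (\<Prod>v\<in>T - {u}. L v x)) = (\<Sum>x\<in>{u}. a x * (\<Prod>v\<in>T - {u}. L v x))"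
    using T u by (intro sum.mono_neutral_right) auto
  moreover have "L v u > 0" if "v \<in> T" "v \<noteq> u" for v
  proof -
    have "\<exists>j\<in>J. \<phi> u j \<noteq> \<phi> v j" using sep that by blast
    then obtain j where "j \<in> J" "\<phi> u j \<noteq> \<phi> v j" by blast
    then have "0 < (\<phi> u j - \<phi> v j) * (\<phi> u j - \<phi> v j)"
      by (metis right_minus_eq not_real_square_gt_zero)
    then show ?thesis unfolding L_def using J \<open>j \<in> J\<close> by (intro sum_pos2[of _ j]) auto
  qed
  then have "(\<Prod>v\<in>T - {u}. L v u) \<noteq> 0" using T by fastforce
  ultimately show ?thesis by simp
qed

text \<open>
  Since \<open>exp (- |x - y|\<^sup>2) = exp (- |x|\<^sup>2) * exp (- |y|\<^sup>2) * exp (2 * \<langle>x, y\<rangle>)\<close>, the exponential series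
  writes the form as a series of power forms of the rescaled weights, with positive coefficients.
\<close>

lemma gaussian_form:
  fixes \<phi> :: "'a \<Rightarrow> 'j \<Rightarrow> real" and c :: "'a \<Rightarrow> real"
  assumes T: "finite T" and J: "finite J"
  defines "Q \<equiv> (\<Sum>u\<in>T. \<Sum>v\<in>T. c u * c v * exp (- (\<Sum>j\<in>J. (\<phi> u j - \<phi> v j)\<^sup>2)))"
  shows gaussian_form_nonneg: "0 \<le> Q"
    and gaussian_form_eq_0D: "Q = 0 \<Longrightarrow> u \<in> T \<Longrightarrow>
      (\<And>v. v \<in> T \<Longrightarrow> v \<noteq> u \<Longrightarrow> \<exists>j\<in>J. \<phi> u j \<noteq> \<phi> v j) \<Longrightarrow> c u = 0"
proof -
  \<comment> \<open>the weights that absorb the factors \<open>exp (- |x|\<^sup>2)\<close>\<close>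
  define a where "a u = c u * exp (- (\<Sum>j\<in>J. (\<phi> u j)\<^sup>2))" for u
  define ip where "ip u v = (\<Sum>j\<in>J. \<phi> u j * \<phi> v j)" for u v
  have *: "(\<Sum>j\<in>J. (\<phi> u j - \<phi> v j)\<^sup>2) = (\<Sum>j\<in>J. (\<phi> u j)\<^sup>2) + (\<Sum>j\<in>J. (\<phi> v j)\<^sup>2) - 2 * ip u v" for u v
    by (simp add: ip_def power2_diff sum.distrib sum_subtractf sum_distrib_left mult.assoc)
  have "c u * c v * exp (- (\<Sum>j\<in>J. (\<phi> u j - \<phi> v j)\<^sup>2)) = a u * a v * exp (2 * ip u v)" for u v
  proof -
    have "exp (- (A + B - 2 * C)) = exp (- A) * exp (- B) * exp (2 * C)" for A B C :: real
      by (simp flip: exp_add)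
    from this[of "\<Sum>j\<in>J. (\<phi> u j)\<^sup>2" "\<Sum>j\<in>J. (\<phi> v j)\<^sup>2" "ip u v"] show ?thesis
      by (simp only: a_def * mult_ac)
  qed
  then have Q: "Q = (\<Sum>u\<in>T. \<Sum>v\<in>T. a u * a v * exp (2 * ip u v))"
    by (simp add: Q_def)
  define s where "s m = 2 ^ m / fact m * power_form T J \<phi> a m" for m
  have "2 ^ m / fact m * (a u * a v * ip u v ^ m) = a u * a v * ((2 * ip u v) ^ m /\<^sub>R fact m)"
    for u v m
    by (simp add: power_mult_distrib divide_inverse mult_ac)
  then have "s m = (\<Sum>u\<in>T. \<Sum>v\<in>T. a u * a v * ((2 * ip u v) ^ m /\<^sub>R fact m))" for m
    unfolding s_def power_form_def ip_def[symmetric] by (simp only: sum_distrib_left)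
  then have s_eq: "s = (\<lambda>m. \<Sum>u\<in>T. \<Sum>v\<in>T. a u * a v * ((2 * ip u v) ^ m /\<^sub>R fact m))"
    by (intro ext)
  have s: "s sums Q"
    unfolding Q s_eq
    by (rule sums_sum, rule sums_sum, rule sums_mult, rule exp_converges)
  have pos: "0 \<le> s m" for m by (simp add: s_def power_form_nonneg)
  show "0 \<le> Q" using s pos by (metis sums_iff suminf_nonneg)
  assume "Q = 0" and u: "u \<in> T"
    and sep: "\<And>v. v \<in> T \<Longrightarrow> v \<noteq> u \<Longrightarrow> \<exists>j\<in>J. \<phi> u j \<noteq> \<phi> v j"
  then have "s m = 0" for m
    using s pos suminf_eq_zero_iff[of s] by (auto simp: sums_iff)
  then have null: "power_form T J \<phi> a m = 0" for m
    by (simp add: s_def)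
  have "a u = 0"
    by (rule monomial_null_weights[where \<phi> = \<phi>, OF T J u power_form_null_monomial[OF J null] sep])
  then show "c u = 0" by (simp add: a_def)
qed


section \<open>The kernels of the integral representation on measures with vanishing marginals\<close>

lemma sqdists_apply:
  "i \<in> {1..n} \<Longrightarrow> sqdists n d u v i = (\<Sum>j=1..d. (u i j - v i j)\<^sup>2)"
  by (simp add: sqdists_def L2_set_def sum_nonneg)

lemma sqdists_orthant: "sqdists n d u v \<in> orthant {1..n}"
  by (auto simp: sqdists_def orthant_def)

lemma open_orthant_D: "r \<in> open_orthant I \<Longrightarrow> i \<in> I \<Longrightarrow> 0 < r i"
  by (auto simp: open_orthant_def)

lemma orthant_D: "r \<in> orthant I \<Longrightarrow> i \<in> I \<Longrightarrow> 0 \<le> r i"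
  by (auto simp: orthant_def)

lemma PiE_neqE:
  assumes "x \<in> Pi\<^sub>E I X" "y \<in> Pi\<^sub>E I Y" "x \<noteq> y"
  obtains i where "i \<in> I" "x i \<noteq> y i"
  using assms by (auto simp: PiE_def extensional_def fun_eq_iff) metis

definition gauss_qform :: "nat \<Rightarrow> nat \<Rightarrow> ((nat \<Rightarrow> nat \<Rightarrow> real) \<Rightarrow> real) \<Rightarrow> (nat \<Rightarrow> real) \<Rightarrow> real" where
  "gauss_qform n d \<mu> r = qform \<mu> (\<lambda>u v. exp (- (\<Sum>i=1..n. r i * sqdists n d u v i)))"

lemma
  assumes \<mu>: "discrete_measure (Pi\<^sub>E {1..n} (\<lambda>_. Rd d)) \<mu>"
  shows gauss_qform_nonneg: "(\<And>i. i \<in> {1..n} \<Longrightarrow> 0 \<le> r i) \<Longrightarrow> 0 \<le> gauss_qform n d \<mu> r"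
    and gauss_qform_pos: "r \<in> open_orthant {1..n} \<Longrightarrow> \<mu> \<noteq> (\<lambda>_. 0) \<Longrightarrow> 0 < gauss_qform n d \<mu> r"
proof -
  define T where "T = {x. \<mu> x \<noteq> 0}"
  have T: "finite T" "T \<subseteq> Pi\<^sub>E {1..n} (\<lambda>_. Rd d)"
    using \<mu> by (auto simp: T_def discrete_measure_def)
  define J where "J = {1..n} \<times> {1..d}"
  define \<phi> :: "(nat \<Rightarrow> nat \<Rightarrow> real) \<Rightarrow> nat \<times> nat \<Rightarrow> real"
    where "\<phi> u = (\<lambda>(i, j). sqrt (r i) * u i j)" for u
  have J: "finite J" by (simp add: J_def)
  have eq: "gauss_qform n d \<mu> r = (\<Sum>u\<in>T. \<Sum>v\<in>T. \<mu> u * \<mu> v * exp (- (\<Sum>j\<in>J. (\<phi> u j - \<phi> v j)\<^sup>2)))"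
    if r: "\<And>i. i \<in> {1..n} \<Longrightarrow> 0 \<le> r i"
  proof -
    have "(\<Sum>j\<in>J. (\<phi> u j - \<phi> v j)\<^sup>2) = (\<Sum>i=1..n. r i * sqdists n d u v i)" for u v
    proof -
      have "(\<Sum>j\<in>J. (\<phi> u j - \<phi> v j)\<^sup>2) = (\<Sum>i=1..n. \<Sum>j=1..d. (sqrt (r i) * u i j - sqrt (r i) * v i j)\<^sup>2)"
        by (simp add: J_def \<phi>_def sum.cartesian_product case_prod_unfold)
      also have "\<dots> = (\<Sum>i=1..n. r i * sqdists n d u v i)"
        using r by (intro sum.cong refl)
          (simp add: sqdists_apply sum_distrib_left right_diff_distrib[symmetric] power_mult_distrib)
      finally show ?thesis .
    qed
    then show ?thesis by (simp add: gauss_qform_def qform_eq_sum T_def)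
  qed
  show "0 \<le> gauss_qform n d \<mu> r" if "\<And>i. i \<in> {1..n} \<Longrightarrow> 0 \<le> r i"
    by (subst eq, rule that, assumption, rule gaussian_form_nonneg[OF T(1) J])
  assume r: "r \<in> open_orthant {1..n}" and nz: "\<mu> \<noteq> (\<lambda>_. 0)"
  have r0: "0 \<le> r i" if "i \<in> {1..n}" for i using open_orthant_D[OF r that] by simp
  have "gauss_qform n d \<mu> r \<noteq> 0"
  proof
    assume 0: "gauss_qform n d \<mu> r = 0"
    have "\<mu> u = 0" if u: "u \<in> T" for u
    proof (rule gaussian_form_eq_0D[OF T(1) J _ u])
      show "(\<Sum>u\<in>T. \<Sum>v\<in>T. \<mu> u * \<mu> v * exp (- (\<Sum>j\<in>J. (\<phi> u j - \<phi> v j)\<^sup>2))) = 0"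
        using 0 eq[OF r0] by simp
      fix v assume v: "v \<in> T" "v \<noteq> u"
      have uv: "u \<in> Pi\<^sub>E {1..n} (\<lambda>_. Rd d)" "v \<in> Pi\<^sub>E {1..n} (\<lambda>_. Rd d)"
        using u v T by auto
      then obtain i where i: "i \<in> {1..n}" "u i \<noteq> v i"
        using v(2) by (metis PiE_neqE)
      then have "u i \<in> Rd d" "v i \<in> Rd d" using uv by (auto simp: PiE_iff)
      then obtain j where j: "j \<in> {1..d}" "u i j \<noteq> v i j"
        using i(2) unfolding Rd_def by (metis PiE_neqE)
      show "\<exists>j\<in>J. \<phi> u j \<noteq> \<phi> v j"
        using i j open_orthant_D[OF r i(1)] by (intro bexI[of _ "(i, j)"]) (auto simp: \<phi>_def J_def)
    qed
    then show False using nz by (auto simp: T_def)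
  qed
  moreover have "0 \<le> gauss_qform n d \<mu> r"
    by (subst eq, rule r0, assumption, rule gaussian_form_nonneg[OF T(1) J])
  ultimately show "0 < gauss_qform n d \<mu> r" by simp
qed

lemma esym_top: "esym n n x = (\<Prod>i=1..n. x i)"
proof -
  have "{S. S \<subseteq> {1..n} \<and> card S = n} = {{1..n}}"
    using card_subset_eq[of "{1..n}"] by auto
  then show ?thesis by (simp add: esym_def)
qed

text \<open>
  In the expansion of \<open>E_fun\<close> every term but the full product depends on fewer than \<open>k\<close> coordinates,
  and so is invisible to a measure whose marginals of these orders vanish.
\<close>

lemma qform_E_fun:
  assumes \<mu>: "\<mu> \<in> M_space k n (\<lambda>_. Rd d)" and "k \<le> n"
  shows "qform \<mu> (\<lambda>u v. E_fun k n (\<lambda>i. r i * sqdists n d u v i)) = gauss_qform n d \<mu> r"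
proof -
  have low: "qform \<mu> (\<lambda>u v. esym j n (\<lambda>i. exp (- (r i * sqdists n d u v i)))) = 0" if "j < k" for j
    unfolding esym_def qform_sum
  proof (rule sum.neutral, safe)
    fix S assume S: "S \<subseteq> {1..n}" "j = card S"
    show "qform \<mu> (\<lambda>u v. \<Prod>i\<in>S. exp (- (r i * sqdists n d u v i))) = 0"
    proof (rule qform_M_space_eq_0[OF \<mu> S(1) _ \<open>k \<le> n\<close>])
      fix x y v :: "nat \<Rightarrow> nat \<Rightarrow> real" assume "\<forall>i\<in>S. x i = y i"
      then show "(\<Prod>i\<in>S. exp (- (r i * sqdists n d x v i))) = (\<Prod>i\<in>S. exp (- (r i * sqdists n d y v i)))"
        using S(1) by (intro prod.cong refl) (auto simp: sqdists_def)
    qed (use S that in auto)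
  qed
  have "qform \<mu> (\<lambda>u v. E_fun k n (\<lambda>i. r i * sqdists n d u v i))
      = qform \<mu> (\<lambda>u v. esym n n (\<lambda>i. exp (- (r i * sqdists n d u v i))))"
    unfolding E_fun_def H_fun_def qform_add qform_sum qform_mult using low by simp
  also have "\<dots> = gauss_qform n d \<mu> r"
    by (simp add: esym_top gauss_qform_def exp_sum[symmetric] sum_negf)
  finally show ?thesis .
qed

lemma qform_mid_kernel:
  assumes "\<mu> \<in> M_space k n (\<lambda>_. Rd d)" "k \<le> n"
  shows "qform \<mu> (\<lambda>u v. (-1) ^ k * mid_kernel k n (sqdists n d u v) r)
    = esym k n (\<lambda>i. r i + 1) / esym k n r * gauss_qform n d \<mu> r"
proof -
  have "qform \<mu> (\<lambda>u v. (-1) ^ k * mid_kernel k n (sqdists n d u v) r)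
      = qform \<mu> (\<lambda>u v. esym k n (\<lambda>i. r i + 1) / esym k n r * E_fun k n (\<lambda>i. r i * sqdists n d u v i))"
    by (simp add: mid_kernel_def mult_ac flip: power_add mult_2)
  then show ?thesis by (simp only: qform_mult qform_E_fun[OF assms])
qed

lemma esym_nonneg: "(\<And>i. i \<in> {1..n} \<Longrightarrow> 0 \<le> r i) \<Longrightarrow> 0 \<le> esym k n r"
  unfolding esym_def by (intro sum_nonneg prod_nonneg) auto

lemma esym_pos:
  assumes "k \<le> n" "\<And>i. i \<in> {1..n} \<Longrightarrow> 0 < r i"
  shows "0 < esym k n r"
  unfolding esym_def
proof (rule sum_pos2[of _ "{1..k}"])
  show "{1..k} \<in> {S. S \<subseteq> {1..n} \<and> card S = k}" using assms(1) by auto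
  show "0 < (\<Prod>i\<in>{1..k}. r i)" using assms by (intro prod_pos) auto
  show "0 \<le> (\<Prod>i\<in>S. r i)" if "S \<in> {S. S \<subseteq> {1..n} \<and> card S = k}" for S
    using assms that by (intro prod_nonneg) (force intro: less_imp_le)
qed auto

text \<open>
  On the open orthant the same cancellation happens in the expansion of the product of the
  \<open>1 - exp (- (r i * t i))\<close>.
\<close>

lemma qform_full_kernel:
  assumes \<mu>: "\<mu> \<in> M_space n n (\<lambda>_. Rd d)" and r: "r \<in> open_orthant {1..n}"
  shows "qform \<mu> (\<lambda>u v. (-1) ^ n * (\<Prod>i=1..n. bern_factor (r i) (sqdists n d u v i)))
    = (\<Prod>i=1..n. (1 + r i) / r i) * gauss_qform n d \<mu> r"
proof -
  define e where "e u v i = exp (- (r i * sqdists n d u v i))" for u v i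
  have bern: "(\<Prod>i=1..n. bern_factor (r i) (sqdists n d u v i))
      = (\<Prod>i=1..n. (1 + r i) / r i) * (\<Sum>S\<in>Pow {1..n}. (-1) ^ card S * (\<Prod>i\<in>S. e u v i))" for u v
  proof -
    have "(\<Prod>i=1..n. bern_factor (r i) (sqdists n d u v i))
        = (\<Prod>i=1..n. (1 + r i) / r i) * (\<Prod>i=1..n. - e u v i + 1)"
      unfolding prod.distrib[symmetric] using open_orthant_D[OF r]
      by (intro prod.cong refl) (force simp: bern_factor_def e_def)
    also have "(\<Prod>i=1..n. - e u v i + 1) = (\<Sum>S\<in>Pow {1..n}. (-1) ^ card S * (\<Prod>i\<in>S. e u v i))"
      by (subst prod_add) (simp_all add: prod_uminus)
    finally show ?thesis .
  qed
  have low: "qform \<mu> (\<lambda>u v. \<Prod>i\<in>S. e u v i) = 0" if S: "S \<subseteq> {1..n}" "S \<noteq> {1..n}" for S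
  proof (rule qform_M_space_eq_0[OF \<mu> S(1)])
    show "card S < n" using psubset_card_mono[of "{1..n}" S] S by auto
    fix x y v :: "nat \<Rightarrow> nat \<Rightarrow> real" assume "\<forall>i\<in>S. x i = y i"
    then show "(\<Prod>i\<in>S. e x v i) = (\<Prod>i\<in>S. e y v i)"
      using S(1) by (intro prod.cong refl) (auto simp: sqdists_def e_def)
  qed simp
  have "(\<Sum>S\<in>Pow {1..n}. (-1) ^ card S * qform \<mu> (\<lambda>u v. \<Prod>i\<in>S. e u v i))
      = (\<Sum>S\<in>{{1..n}}. (-1) ^ card S * qform \<mu> (\<lambda>u v. \<Prod>i\<in>S. e u v i))"
    using low by (intro sum.mono_neutral_right) auto
  moreover have "qform \<mu> (\<lambda>u v. \<Prod>i=1..n. e u v i) = gauss_qform n d \<mu> r"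
    by (simp add: e_def gauss_qform_def exp_sum[symmetric] sum_negf)
  ultimately have "qform \<mu> (\<lambda>u v. (-1) ^ n * (\<Prod>i=1..n. bern_factor (r i) (sqdists n d u v i)))
      = (-1) ^ n * ((\<Prod>i=1..n. (1 + r i) / r i) * ((-1) ^ n * gauss_qform n d \<mu> r))"
    unfolding bern qform_mult qform_sum by simp
  then show ?thesis by (simp add: mult_ac flip: power_add mult_2)
qed

text \<open>
  Parameters on the boundary, where some factors degenerate to \<open>t i\<close>, are limits of interior ones.
\<close>

lemma qform_full_kernel_nonneg:
  assumes \<mu>: "\<mu> \<in> M_space n n (\<lambda>_. Rd d)" and r: "r \<in> orthant {1..n}"
  shows "0 \<le> qform \<mu> (\<lambda>u v. (-1) ^ n * (\<Prod>i=1..n. bern_factor (r i) (sqdists n d u v i)))"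
proof (rule tendsto_lowerbound)
  define rs where "rs s = (\<lambda>i\<in>{1..n}. r i + s)" for s
  have "((\<lambda>s. bern_factor (r i + s) t) \<longlongrightarrow> bern_factor (r i) t) (at_right 0)" if "i \<in> {1..n}" for i t
  proof (cases "r i = 0")
    case True
    have "((\<lambda>s. (1 - exp (- (s * t))) * ((1 + s) / s)) \<longlongrightarrow> t) (at_right 0)"
    proof -
      have "((\<lambda>s. 1 - exp (- (s * t))) has_real_derivative t) (at 0)"
        by (auto intro!: derivative_eq_intros)
      then have "((\<lambda>s. (1 - exp (- (s * t))) / s) \<longlongrightarrow> t) (at_right 0)"
        by (auto simp: has_field_derivative_iff intro: filterlim_mono at_le)
      then have "((\<lambda>s. (1 - exp (- (s * t))) / s * (1 + s)) \<longlongrightarrow> t * (1 + 0)) (at_right 0)"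
        by (intro tendsto_intros)
      then show ?thesis by simp
    qed
    moreover have "\<forall>\<^sub>F s in at_right 0. (1 - exp (- (s * t))) * ((1 + s) / s) = bern_factor s t"
      by (auto simp: bern_factor_def eventually_at_filter)
    ultimately show ?thesis using True by (auto simp: bern_factor_def elim: Lim_transform_eventually)
  next
    case False
    have "((\<lambda>s. (1 - exp (- ((r i + s) * t))) * ((1 + (r i + s)) / (r i + s)))
      \<longlongrightarrow> (1 - exp (- ((r i + 0) * t))) * ((1 + (r i + 0)) / (r i + 0))) (at_right 0)"
      using False by (intro tendsto_intros) auto
    moreover have "\<forall>\<^sub>F s in at_right 0. (1 - exp (- ((r i + s) * t))) * ((1 + (r i + s)) / (r i + s))
        = bern_factor (r i + s) t"
      using orthant_D[OF r that] by (auto simp: bern_factor_def eventually_at_filter)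
    ultimately show ?thesis using False by (auto simp: bern_factor_def elim: Lim_transform_eventually)
  qed
  then show "((\<lambda>s. qform \<mu> (\<lambda>u v. (-1) ^ n * (\<Prod>i=1..n. bern_factor (rs s i) (sqdists n d u v i))))
     \<longlongrightarrow> qform \<mu> (\<lambda>u v. (-1) ^ n * (\<Prod>i=1..n. bern_factor (r i) (sqdists n d u v i)))) (at_right 0)"
    by (intro tendsto_qform tendsto_mult_left tendsto_prod) (auto simp: rs_def)
  show "\<forall>\<^sub>F s in at_right 0. 0 \<le> qform \<mu> (\<lambda>u v. (-1) ^ n * (\<Prod>i=1..n. bern_factor (rs s i) (sqdists n d u v i)))"
    unfolding eventually_at_filter
  proof (rule always_eventually, safe)
    fix s :: real assume "0 < s"
    then have rs: "rs s \<in> open_orthant {1..n}"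
      using orthant_D[OF r] by (force simp: rs_def open_orthant_def intro: add_nonneg_pos)
    have rs0: "0 \<le> rs s i" if "i \<in> {1..n}" for i using open_orthant_D[OF rs that] by simp
    have "0 \<le> (\<Prod>i=1..n. (1 + rs s i) / rs s i)" using rs0 by (intro prod_nonneg) auto
    then show "0 \<le> qform \<mu> (\<lambda>u v. (-1) ^ n * (\<Prod>i=1..n. bern_factor (rs s i) (sqdists n d u v i)))"
      unfolding qform_full_kernel[OF \<mu> rs]
      using gauss_qform_nonneg[OF M_space_discrete[OF \<mu>]] rs0 by (intro mult_nonneg_nonneg) auto
  qed
qed simp


section \<open>A measure annihilated by all degenerate kernels\<close>

definition tensor :: "nat \<Rightarrow> ('a \<Rightarrow> real) \<Rightarrow> (nat \<Rightarrow> 'a) \<Rightarrow> real" where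
  "tensor n \<tau> x = (if x \<in> extensional {1..n} then \<Prod>i=1..n. \<tau> (x i) else 0)"

lemma support_tensor: "{x. tensor n \<tau> x \<noteq> 0} \<subseteq> (\<Pi>\<^sub>E i\<in>{1..n}. {y. \<tau> y \<noteq> 0})"
  by (auto simp: tensor_def PiE_iff extensional_def split: if_splits)

lemma discrete_measure_tensor:
  assumes "discrete_measure S \<tau>"
  shows "discrete_measure (\<Pi>\<^sub>E i\<in>{1..n}. S) (tensor n \<tau>)"
proof -
  have "finite (\<Pi>\<^sub>E i\<in>{1..n}. {y. \<tau> y \<noteq> 0})"
    using assms by (intro finite_PiE) (auto simp: discrete_measure_def)
  moreover have "(\<Pi>\<^sub>E i\<in>{1..n}. {y. \<tau> y \<noteq> 0}) \<subseteq> (\<Pi>\<^sub>E i\<in>{1..n}. S)"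
    using assms by (intro PiE_mono) (auto simp: discrete_measure_def)
  ultimately show ?thesis
    using support_tensor[of n \<tau>] by (auto simp: discrete_measure_def intro: finite_subset)
qed

lemma dint_tensor:
  assumes "discrete_measure S \<tau>"
  shows "dint (tensor n \<tau>) (\<lambda>x. \<Prod>i=1..n. f i (x i)) = (\<Prod>i=1..n. dint \<tau> (f i))"
proof -
  define Z where "Z = {y. \<tau> y \<noteq> 0}"
  have Z: "finite Z" using assms by (simp add: Z_def discrete_measure_def)
  have "dint (tensor n \<tau>) (\<lambda>x. \<Prod>i=1..n. f i (x i))
      = (\<Sum>x\<in>(\<Pi>\<^sub>E i\<in>{1..n}. Z). (\<Prod>i=1..n. f i (x i)) * tensor n \<tau> x)"
    unfolding Z_def
    by (intro dint_superset support_tensor finite_PiE) (use Z in \<open>auto simp: Z_def\<close>)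
  also have "\<dots> = (\<Sum>x\<in>(\<Pi>\<^sub>E i\<in>{1..n}. Z). \<Prod>i=1..n. f i (x i) * \<tau> (x i))"
    by (intro sum.cong refl) (auto simp: tensor_def PiE_def prod.distrib)
  also have "\<dots> = (\<Prod>i=1..n. \<Sum>y\<in>Z. f i y * \<tau> y)"
    using Z by (intro prod_sum_PiE[symmetric]) auto
  finally show ?thesis by (simp add: dint_def Z_def)
qed

lemma qform_tensor:
  assumes "discrete_measure S \<tau>"
  shows "qform (tensor n \<tau>) (\<lambda>u v. \<Prod>i=1..n. h i (u i) (v i)) = (\<Prod>i=1..n. qform \<tau> (h i))"
proof -
  have "dint (tensor n \<tau>) (\<lambda>u. \<Prod>i=1..n. h i (u i) (v i)) = (\<Prod>i=1..n. dint \<tau> (\<lambda>y. h i y (v i)))" for v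
    by (rule dint_tensor[OF assms, where f = "\<lambda>i y. h i y (v i)"])
  then show ?thesis
    unfolding qform_def
    by (simp only: dint_tensor[OF assms, where f = "\<lambda>i z. dint \<tau> (\<lambda>y. h i y z)"])
qed

lemma dint_tensor_cylinder:
  assumes "discrete_measure S \<tau>" "G \<subseteq> {1..n}"
  shows "dint (tensor n \<tau>) (\<lambda>x. \<Prod>i\<in>G. f i (x i))
    = (\<Prod>i\<in>G. dint \<tau> (f i)) * dint \<tau> (\<lambda>_. 1) ^ (n - card G)"
proof -
  have fin: "finite G" using assms(2) finite_subset by blast
  have *: "(\<Prod>i=1..n. if i \<in> G then a i else b i) = (\<Prod>i\<in>G. a i) * (\<Prod>i\<in>{1..n} - G. b i)"
    for a b :: "nat \<Rightarrow> real"
    using assms(2) by (simp add: prod.If_cases Int_absorb1 Diff_eq)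
  have "dint (tensor n \<tau>) (\<lambda>x. \<Prod>i\<in>G. f i (x i))
      = dint (tensor n \<tau>) (\<lambda>x. \<Prod>i=1..n. (if i \<in> G then f i else (\<lambda>_. 1)) (x i))"
    by (simp only: if_distribR *) simp
  also have "\<dots> = (\<Prod>i=1..n. if i \<in> G then dint \<tau> (f i) else dint \<tau> (\<lambda>_. 1))"
    unfolding dint_tensor[OF assms(1), where f = "\<lambda>i. if i \<in> G then f i else (\<lambda>_. 1)"]
    by (intro prod.cong) auto
  finally show ?thesis
    unfolding * using assms(2) fin by (simp add: card_Diff_subset)
qed

lemma tensor_M_space:
  assumes "discrete_measure S \<tau>" "dint \<tau> (\<lambda>_. 1) = 0"
  shows "tensor n \<tau> \<in> M_space n n (\<lambda>_. S)"
proof (rule M_spaceI[OF discrete_measure_tensor[OF assms(1)]])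
  fix G A assume "G \<subseteq> {1..n}" "card G < n"
  then show "dint (tensor n \<tau>) (\<lambda>x. \<Prod>i\<in>G. of_bool (x i \<in> A i)) = 0"
    using dint_tensor_cylinder[OF assms(1), of G n "\<lambda>i y. of_bool (y \<in> A i)"] assms(2) by simp
qed simp

definition pt :: "real \<Rightarrow> nat \<Rightarrow> real" where
  "pt a = (\<lambda>j\<in>{1..1}. a)"

lemma pt_eq_iff: "pt a = pt b \<longleftrightarrow> a = b"
  by (auto simp: pt_def fun_eq_iff restrict_def)

lemma pt_1: "pt a (Suc 0) = a"
  by (simp add: pt_def)

text \<open>
  The quadratic form of a second difference on the line annihilates both \<open>1\<close> and \<open>|u - v|\<^sup>2\<close>, the two
  forms that a factor of a kernel takes when its parameter is zero. The factor \<open>1 / 6\<close> makes the uniform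
  distribution on the three points dominate its absolute value.
\<close>

definition second_difference :: "(nat \<Rightarrow> real) \<Rightarrow> real" where
  "second_difference y =
     (if y = pt 0 then 1 / 6 else if y = pt 1 then - 1 / 3 else if y = pt 2 then 1 / 6 else 0)"

definition uniform3 :: "(nat \<Rightarrow> real) \<Rightarrow> real" where
  "uniform3 y = (if y \<in> {pt 0, pt 1, pt 2} then 1 / 3 else 0)"

lemma discrete_second_difference: "discrete_measure (Rd 1) second_difference"
  and discrete_uniform3: "discrete_measure (Rd 1) uniform3"
proof -
  have "{y. second_difference y \<noteq> 0} \<subseteq> {pt 0, pt 1, pt 2}" "{y. uniform3 y \<noteq> 0} \<subseteq> {pt 0, pt 1, pt 2}"
    by (auto simp: second_difference_def uniform3_def)
  moreover have "{pt 0, pt 1, pt 2} \<subseteq> Rd 1"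
    by (auto simp: Rd_def pt_def)
  ultimately show "discrete_measure (Rd 1) second_difference" "discrete_measure (Rd 1) uniform3"
    unfolding discrete_measure_def by (meson finite.emptyI finite_insert finite_subset order_trans)+
qed

lemma dint_second_difference:
  "dint second_difference f = (f (pt 0) - 2 * f (pt 1) + f (pt 2)) / 6"
proof -
  have "dint second_difference f = (\<Sum>y\<in>{pt 0, pt 1, pt 2}. f y * second_difference y)"
    by (rule dint_superset) (auto simp: second_difference_def)
  then show ?thesis by (simp add: second_difference_def pt_eq_iff field_simps)
qed

lemma dint_uniform3: "dint uniform3 f = (f (pt 0) + f (pt 1) + f (pt 2)) / 3"
proof -
  have "dint uniform3 f = (\<Sum>y\<in>{pt 0, pt 1, pt 2}. f y * uniform3 y)"
    by (rule dint_superset) (auto simp: uniform3_def)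
  then show ?thesis by (simp add: uniform3_def pt_eq_iff field_simps)
qed

abbreviation witness :: "nat \<Rightarrow> (nat \<Rightarrow> nat \<Rightarrow> real) \<Rightarrow> real" where
  "witness n \<equiv> tensor n second_difference"

lemma witness_M_space: "witness n \<in> M_space n n (\<lambda>_. Rd 1)"
  by (rule tensor_M_space[OF discrete_second_difference]) (simp add: dint_second_difference)

lemma witness_nonzero: "witness n \<noteq> (\<lambda>_. 0)"
proof -
  have "witness n (\<lambda>i\<in>{1..n}. pt 0) = (1 / 6) ^ n"
    by (simp add: tensor_def second_difference_def)
  then show ?thesis by (metis divide_eq_0_iff power_not_zero zero_neq_numeral zero_neq_one)
qed

lemma witness_gauss_qform:
  assumes i: "i \<in> {1..n}" "r i = 0"
  shows "gauss_qform n 1 (witness n) r = 0"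
proof -
  have "gauss_qform n 1 (witness n) r
      = qform (witness n) (\<lambda>u v. \<Prod>i=1..n. exp (- (r i * (u i 1 - v i 1)\<^sup>2)))"
    by (simp add: gauss_qform_def sqdists_apply exp_sum[symmetric] sum_negf)
  also have "\<dots> = (\<Prod>i=1..n. qform second_difference (\<lambda>y z. exp (- (r i * (y 1 - z 1)\<^sup>2))))"
    by (rule qform_tensor[OF discrete_second_difference])
  also have "\<dots> = 0"
    using i by (intro prod_zero bexI[of _ i]) (auto simp: qform_def dint_second_difference)
  finally show ?thesis .
qed

lemma witness_full_kernel:
  assumes i: "i \<in> {1..n}" "r i = 0"
  shows "qform (witness n) (\<lambda>u v. \<Prod>i=1..n. bern_factor (r i) (sqdists n 1 u v i)) = 0"
proof -
  have "qform (witness n) (\<lambda>u v. \<Prod>i=1..n. bern_factor (r i) (sqdists n 1 u v i))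
      = qform (witness n) (\<lambda>u v. \<Prod>i=1..n. bern_factor (r i) ((u i 1 - v i 1)\<^sup>2))"
    by (simp add: sqdists_apply)
  also have "\<dots> = (\<Prod>i=1..n. qform second_difference (\<lambda>y z. bern_factor (r i) ((y 1 - z 1)\<^sup>2)))"
    by (rule qform_tensor[OF discrete_second_difference])
  also have "\<dots> = 0"
    using i by (intro prod_zero bexI[of _ i])
      (auto simp: qform_def dint_second_difference bern_factor_def pt_1)
  finally show ?thesis .
qed


section \<open>Strictness and the mass of the open orthant\<close>

lemma PDI_qform:
  "PDI k n g \<longleftrightarrow> (\<forall>d. \<forall>\<mu> \<in> M_space k n (\<lambda>_. Rd d). 0 \<le> qform \<mu> (\<lambda>u v. (-1) ^ k * g (sqdists n d u v)))"
  by (simp add: PDI_def qform_def)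

lemma SPDI_qform:
  "SPDI k n g \<longleftrightarrow> PDI k n g \<and> (\<forall>d. \<forall>\<mu> \<in> M_space k n (\<lambda>_. Rd d).
     qform \<mu> (\<lambda>u v. (-1) ^ k * g (sqdists n d u v)) = 0 \<longrightarrow> \<mu> = (\<lambda>_. 0))"
  by (simp add: SPDI_def qform_def)

lemma finite_borel_measure_on_space:
  assumes "finite_borel_measure_on n \<Omega> \<eta>" "\<Omega> \<subseteq> orthant {1..n}"
  shows "space \<eta> = \<Omega>"
proof -
  have "space \<eta> = space (restrict_space (\<Pi>\<^sub>M i\<in>{1..n}. borel) \<Omega>)"
    using assms(1) by (intro sets_eq_imp_space_eq) (simp add: finite_borel_measure_on_def)
  then show ?thesis
    using assms(2) by (auto simp: space_restrict_space space_PiM orthant_def PiE_iff)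
qed

lemma open_orthant_sets:
  assumes "finite_borel_measure_on n \<Omega> \<eta>" "open_orthant {1..n} \<subseteq> \<Omega>"
  shows "open_orthant {1..n} \<in> sets \<eta>"
proof -
  have "open_orthant {1..n} \<in> sets (\<Pi>\<^sub>M i\<in>{1..n}. borel)"
    unfolding open_orthant_def by (rule sets_PiM_I_finite) auto
  then have "\<Omega> \<inter> open_orthant {1..n} \<in> sets (restrict_space (\<Pi>\<^sub>M i\<in>{1..n}. borel) \<Omega>)"
    by (auto simp: sets_restrict_space)
  then show ?thesis
    using assms by (simp add: finite_borel_measure_on_def Int_absorb1)
qed

text \<open>
  The form of \<open>g\<close> is the integral over \<open>\<eta>\<close> of the forms of the kernels plus the form of a remainder \<open>b\<close>.
  An integral of nonnegative forms can only vanish if almost all of them do, which a charged set of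
  strict kernels excludes.
\<close>

lemma
  fixes \<kappa> :: "(nat \<Rightarrow> real) \<Rightarrow> (nat \<Rightarrow> real) \<Rightarrow> real"
  assumes \<eta>: "finite_borel_measure_on n \<Omega> \<eta>" "open_orthant {1..n} \<subseteq> \<Omega>" "\<Omega> \<subseteq> orthant {1..n}"
    and int: "\<And>t. t \<in> orthant {1..n} \<Longrightarrow> integrable \<eta> (\<kappa> t)"
    and rep: "\<And>t. t \<in> orthant {1..n} \<Longrightarrow> g t = b t + (\<integral>r. \<kappa> t r \<partial>\<eta>)"
  shows SPDI_if_open_orthant_charged:
    "\<lbrakk>PDI k n g; 0 < measure \<eta> (open_orthant {1..n});
      \<And>d \<mu>. \<mu> \<in> M_space k n (\<lambda>_. Rd d) \<Longrightarrow> 0 \<le> qform \<mu> (\<lambda>u v. (-1) ^ k * b (sqdists n d u v));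
      \<And>d \<mu> r. \<mu> \<in> M_space k n (\<lambda>_. Rd d) \<Longrightarrow> r \<in> \<Omega> \<Longrightarrow>
        0 \<le> qform \<mu> (\<lambda>u v. (-1) ^ k * \<kappa> (sqdists n d u v) r);
      \<And>d \<mu> r. \<mu> \<in> M_space k n (\<lambda>_. Rd d) \<Longrightarrow> r \<in> open_orthant {1..n} \<Longrightarrow> \<mu> \<noteq> (\<lambda>_. 0) \<Longrightarrow>
        0 < qform \<mu> (\<lambda>u v. (-1) ^ k * \<kappa> (sqdists n d u v) r)\<rbrakk> \<Longrightarrow> SPDI k n g"
    and form_zero_if_open_orthant_null:
    "\<lbrakk>measure \<eta> (open_orthant {1..n}) = 0; qform \<mu> (\<lambda>u v. b (sqdists n d u v)) = 0;
      \<And>r. r \<in> \<Omega> - open_orthant {1..n} \<Longrightarrow> qform \<mu> (\<lambda>u v. \<kappa> (sqdists n d u v) r) = 0\<rbrakk> \<Longrightarrow>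
      qform \<mu> (\<lambda>u v. g (sqdists n d u v)) = 0"
proof -
  interpret finite_measure \<eta> using \<eta>(1) by (simp add: finite_borel_measure_on_def)
  have sp: "space \<eta> = \<Omega>" using \<eta> by (intro finite_borel_measure_on_space)
  have O: "open_orthant {1..n} \<in> sets \<eta>" using \<eta> by (intro open_orthant_sets)
  \<comment> \<open>one identity for both parts, with \<open>c = (-1) ^ k\<close> and with \<open>c = 1\<close>\<close>
  have split: "qform \<mu> (\<lambda>u v. c * g (sqdists n d u v))
      = qform \<mu> (\<lambda>u v. c * b (sqdists n d u v)) + (\<integral>r. qform \<mu> (\<lambda>u v. c * \<kappa> (sqdists n d u v) r) \<partial>\<eta>)"
    for \<mu> d c
  proof -
    have "(\<integral>r. qform \<mu> (\<lambda>u v. c * \<kappa> (sqdists n d u v) r) \<partial>\<eta>)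
        = qform \<mu> (\<lambda>u v. \<integral>r. c * \<kappa> (sqdists n d u v) r \<partial>\<eta>)"
      by (rule integral_qform) (intro integrable_mult_right int sqdists_orthant)
    then show ?thesis
      by (simp add: rep[OF sqdists_orthant] distrib_left qform_add)
  qed
  show "SPDI k n g"
    if "PDI k n g" and pos: "0 < measure \<eta> (open_orthant {1..n})"
      and b: "\<And>d \<mu>. \<mu> \<in> M_space k n (\<lambda>_. Rd d) \<Longrightarrow> 0 \<le> qform \<mu> (\<lambda>u v. (-1) ^ k * b (sqdists n d u v))"
      and nn: "\<And>d \<mu> r. \<mu> \<in> M_space k n (\<lambda>_. Rd d) \<Longrightarrow> r \<in> \<Omega> \<Longrightarrow>
        0 \<le> qform \<mu> (\<lambda>u v. (-1) ^ k * \<kappa> (sqdists n d u v) r)"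
      and strict: "\<And>d \<mu> r. \<mu> \<in> M_space k n (\<lambda>_. Rd d) \<Longrightarrow> r \<in> open_orthant {1..n} \<Longrightarrow> \<mu> \<noteq> (\<lambda>_. 0) \<Longrightarrow>
        0 < qform \<mu> (\<lambda>u v. (-1) ^ k * \<kappa> (sqdists n d u v) r)"
    unfolding SPDI_qform
  proof (intro conjI allI ballI impI \<open>PDI k n g\<close>)
    fix d \<mu> assume \<mu>: "\<mu> \<in> M_space k n (\<lambda>_. Rd d)"
      and 0: "qform \<mu> (\<lambda>u v. (-1) ^ k * g (sqdists n d u v)) = 0"
    define K where "K r = qform \<mu> (\<lambda>u v. (-1) ^ k * \<kappa> (sqdists n d u v) r)" for r
    have K: "integrable \<eta> K"
      unfolding K_def by (rule integrable_qform) (intro integrable_mult_right int sqdists_orthant)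
    have Kn: "AE r in \<eta>. 0 \<le> K r"
      using nn[OF \<mu>] by (auto simp: K_def sp)
    have "(\<integral>r. K r \<partial>\<eta>) = 0"
      using 0 b[OF \<mu>] integral_nonneg_AE[OF Kn] by (simp add: split K_def)
    then have AE0: "AE r in \<eta>. K r = 0"
      using integral_nonneg_eq_0_iff_AE[OF K Kn] by simp
    show "\<mu> = (\<lambda>_. 0)"
    proof (rule ccontr)
      assume "\<mu> \<noteq> (\<lambda>_. 0)"
      then have "K r \<noteq> 0" if "r \<in> open_orthant {1..n}" for r
        using strict[OF \<mu> that] by (simp add: K_def)
      then have "AE r in \<eta>. r \<notin> open_orthant {1..n}"
        by (intro eventually_mono[OF AE0]) blast
      then have "open_orthant {1..n} \<in> null_sets \<eta>"
        using O by (simp add: AE_iff_null_sets)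
      then show False using pos by (simp add: measure_eq_0_null_sets)
    qed
  qed
  show "qform \<mu> (\<lambda>u v. g (sqdists n d u v)) = 0"
    if null: "measure \<eta> (open_orthant {1..n}) = 0" and b: "qform \<mu> (\<lambda>u v. b (sqdists n d u v)) = 0"
      and \<kappa>: "\<And>r. r \<in> \<Omega> - open_orthant {1..n} \<Longrightarrow> qform \<mu> (\<lambda>u v. \<kappa> (sqdists n d u v) r) = 0"
  proof -
    have "open_orthant {1..n} \<in> null_sets \<eta>"
      using null O by (simp add: null_setsI emeasure_eq_measure)
    then have "AE r in \<eta>. r \<notin> open_orthant {1..n}"
      using O by (simp add: AE_iff_null_sets)
    moreover have "AE r in \<eta>. r \<in> \<Omega>" using sp by auto
    ultimately have "AE r in \<eta>. qform \<mu> (\<lambda>u v. \<kappa> (sqdists n d u v) r) = 0"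
      by eventually_elim (use \<kappa> in auto)
    then have "(\<integral>r. qform \<mu> (\<lambda>u v. \<kappa> (sqdists n d u v) r) \<partial>\<eta>) = 0"
      by (rule integral_eq_zero_AE)
    then show ?thesis using split[of \<mu> 1 d] b by simp
  qed
qed


section \<open>Nonnegativity of the Bernstein terms\<close>

text \<open>
  In \<open>spread\<close> the coordinates in \<open>F\<close> follow the marginal of \<open>\<mu>\<close>. The others share a single point that,
  independently, is uniform among \<open>N\<close> points of the diagonal; in positive dimension these are at
  mutual distance at least \<open>N\<close>.
\<close>

definition spread_point :: "nat \<Rightarrow> nat \<Rightarrow> nat set \<Rightarrow> nat \<Rightarrow> nat \<Rightarrow> (nat \<Rightarrow> nat \<Rightarrow> real) \<Rightarrow> nat \<Rightarrow> nat \<Rightarrow> real" where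
  "spread_point n d F N j x = (\<lambda>i\<in>{1..n}. if i \<in> F then x i else (\<lambda>l\<in>{1..d}. real (N * j)))"

definition spread ::
  "nat \<Rightarrow> nat \<Rightarrow> nat set \<Rightarrow> nat \<Rightarrow> ((nat \<Rightarrow> nat \<Rightarrow> real) \<Rightarrow> real) \<Rightarrow> (nat \<Rightarrow> nat \<Rightarrow> real) \<Rightarrow> real" where
  "spread n d F N \<mu> = point_masses ({..<N} \<times> {x. \<mu> x \<noteq> 0}) (\<lambda>(j, x). \<mu> x / N)
     (\<lambda>(j, x). spread_point n d F N j x)"

lemma dint_spread:
  assumes "discrete_measure S \<mu>"
  shows "dint (spread n d F N \<mu>) f = (\<Sum>j<N. dint \<mu> (\<lambda>x. f (spread_point n d F N j x)) / N)"
proof -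
  have "finite ({..<N} \<times> {x. \<mu> x \<noteq> 0})" using assms by (simp add: discrete_measure_def)
  then have "dint (spread n d F N \<mu>) f
      = (\<Sum>(j, x)\<in>{..<N} \<times> {x. \<mu> x \<noteq> 0}. f (spread_point n d F N j x) * (\<mu> x / N))"
    by (simp add: spread_def dint_point_masses case_prod_unfold)
  then show ?thesis
    by (simp add: sum.cartesian_product[symmetric] dint_def sum_divide_distrib)
qed

lemma qform_spread:
  assumes "discrete_measure S \<mu>"
  shows "qform (spread n d F N \<mu>) h = (\<Sum>l<N. \<Sum>j<N.
    qform \<mu> (\<lambda>u v. h (spread_point n d F N j u) (spread_point n d F N l v)) / (real N)\<^sup>2)"
proof -
  have "dint \<mu> (\<lambda>v. \<Sum>j<N. a j v / N) = (\<Sum>j<N. dint \<mu> (a j) / N)" for a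
    using dint_mult[of \<mu> "1 / real N"] by (simp add: dint_sum)
  then show ?thesis
    unfolding qform_def dint_spread[OF assms]
    by (simp add: sum_divide_distrib power2_eq_square)
qed

lemma spread_M_space:
  assumes \<mu>: "\<mu> \<in> M_space k n (\<lambda>_. Rd d)" and "k \<le> n"
  shows "spread n d F N \<mu> \<in> M_space k n (\<lambda>_. Rd d)"
proof (rule M_spaceI[OF _ \<open>k \<le> n\<close>])
  have \<mu>d: "discrete_measure (\<Pi>\<^sub>E i\<in>{1..n}. Rd d) \<mu>" by (rule M_space_discrete[OF \<mu>])
  show "discrete_measure (\<Pi>\<^sub>E i\<in>{1..n}. Rd d) (spread n d F N \<mu>)"
    unfolding spread_def
  proof (rule discrete_measure_point_masses)
    show "finite ({..<N} \<times> {x. \<mu> x \<noteq> 0})" using \<mu>d by (simp add: discrete_measure_def)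
    fix a assume "a \<in> {..<N} \<times> {x. \<mu> x \<noteq> 0}"
    then have "snd a \<in> {x. \<mu> x \<noteq> 0}" by auto
    then have "snd a \<in> (\<Pi>\<^sub>E i\<in>{1..n}. Rd d)"
      using \<mu>d unfolding discrete_measure_def by blast
    then show "(case a of (j, x) \<Rightarrow> spread_point n d F N j x) \<in> (\<Pi>\<^sub>E i\<in>{1..n}. Rd d)"
      by (auto simp: spread_point_def case_prod_unfold PiE_iff Rd_def extensional_def)
  qed
  fix G A assume G: "G \<subseteq> {1..n}" "card G < k"
  then have "card (G \<inter> F) < k"
    by (meson card_mono finite_atLeastAtMost finite_subset inf_le1 le_less_trans)
  then have "dint \<mu> (\<lambda>x. \<Prod>i\<in>G. of_bool (spread_point n d F N j x i \<in> A i)) = 0" for j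
    using G by (intro dint_M_space_eq_0[OF \<mu> _ _ \<open>k \<le> n\<close>, of "G \<inter> F"])
      (auto intro!: prod.cong simp: spread_point_def)
  then show "dint (spread n d F N \<mu>) (\<lambda>x. \<Prod>i\<in>G. of_bool (x i \<in> A i)) = 0"
    by (simp add: dint_spread[OF \<mu>d])
qed

lemma sqdists_spread_point:
  assumes "i \<in> {1..n}"
  shows "sqdists n d (spread_point n d F N j u) (spread_point n d F N l v) i
    = (if i \<in> F then sqdists n d u v i else real d * (real N * (real j - real l))\<^sup>2)"
  using assms by (simp add: sqdists_apply spread_point_def right_diff_distrib)

text \<open>By independence the Gaussian form factors, and the points enter through one average only.\<close>

lemma gauss_qform_spread:
  assumes \<mu>: "discrete_measure S \<mu>" and F: "F \<subseteq> {1..n}"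
  shows "gauss_qform n d (spread n d F N \<mu>) r
    = (\<Sum>l<N. \<Sum>j<N. exp (- (sum r ({1..n} - F) * (real d * (real N * (real j - real l))\<^sup>2))))
        / (real N)\<^sup>2 * qform \<mu> (\<lambda>u v. exp (- (\<Sum>i\<in>F. r i * sqdists n d u v i)))"
proof -
  define \<rho> where "\<rho> = sum r ({1..n} - F)"
  have exponent: "(\<Sum>i=1..n. r i * sqdists n d (spread_point n d F N j u) (spread_point n d F N l v) i)
      = (\<Sum>i\<in>F. r i * sqdists n d u v i) + \<rho> * (real d * (real N * (real j - real l))\<^sup>2)" for j l u v
  proof -
    have "(\<Sum>i=1..n. r i * sqdists n d (spread_point n d F N j u) (spread_point n d F N l v) i)
        = (\<Sum>i=1..n. if i \<in> F then r i * sqdists n d u v i else r i * (real d * (real N * (real j - real l))\<^sup>2))"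
      by (intro sum.cong refl) (simp only: sqdists_spread_point split: if_splits, simp)
    also have "\<dots> = (\<Sum>i\<in>F. r i * sqdists n d u v i)
        + (\<Sum>i\<in>{1..n} - F. r i * (real d * (real N * (real j - real l))\<^sup>2))"
      using F by (subst sum.If_cases) (simp_all only: finite_atLeastAtMost Int_absorb1 Collect_mem_eq Diff_eq Collect_neg_eq)
    finally show ?thesis by (simp add: \<rho>_def sum_distrib_right)
  qed
  define E where "E j l = exp (- (\<rho> * (real d * (real N * (real j - real l))\<^sup>2)))" for j l :: nat
  define q where "q = qform \<mu> (\<lambda>u v. exp (- (\<Sum>i\<in>F. r i * sqdists n d u v i)))"
  have factor: "exp (- (\<Sum>i=1..n. r i * sqdists n d (spread_point n d F N j u) (spread_point n d F N l v) i))
      = E j l * exp (- (\<Sum>i\<in>F. r i * sqdists n d u v i))" for j l u v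
    unfolding exponent E_def by (simp flip: exp_add)
  have eq: "qform \<mu> (\<lambda>u v. exp (- (\<Sum>i=1..n. r i * sqdists n d (spread_point n d F N j u) (spread_point n d F N l v) i)))
      = E j l * q" for j l
    unfolding q_def qform_mult[symmetric] by (rule qform_cong) (rule factor)
  have "gauss_qform n d (spread n d F N \<mu>) r = (\<Sum>l<N. \<Sum>j<N. qform \<mu> (\<lambda>u v.
      exp (- (\<Sum>i=1..n. r i * sqdists n d (spread_point n d F N j u) (spread_point n d F N l v) i)))
        / (real N)\<^sup>2)"
    unfolding gauss_qform_def
    by (rule qform_spread[OF \<mu>, where h = "\<lambda>u v. exp (- (\<Sum>i=1..n. r i * sqdists n d u v i))"])
  also have "\<dots> = (\<Sum>l<N. \<Sum>j<N. E j l * q / (real N)\<^sup>2)"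
  proof (rule sum.cong[OF refl], rule sum.cong[OF refl])
    fix l j
    show "qform \<mu> (\<lambda>u v. exp (- (\<Sum>i=1..n. r i * sqdists n d (spread_point n d F N j u) (spread_point n d F N l v) i)))
        / (real N)\<^sup>2 = E j l * q / (real N)\<^sup>2"
      unfolding eq[of j l] by (rule refl)
  qed
  finally show ?thesis
    unfolding \<rho>_def[symmetric] E_def[symmetric] q_def[symmetric] sum_divide_distrib sum_distrib_right
    by (simp only: times_divide_eq_left)
qed

text \<open>
  The \<open>N\<close> diagonal terms of the average contribute \<open>1 / N\<close>, and the others are small since the points
  are far apart.
\<close>

lemma spread_average_bounds:
  fixes \<rho> :: real
  assumes "0 \<le> \<rho>" "d \<ge> 1" "N \<ge> 1"
  defines "\<alpha> \<equiv> (\<Sum>l<N. \<Sum>j<N. exp (- (\<rho> * (real d * (real N * (real j - real l))\<^sup>2)))) / (real N)\<^sup>2"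
  shows "0 \<le> \<alpha>" "\<alpha> \<le> 1" "\<alpha> \<le> 1 / real N + exp (- (\<rho> * real N))"
proof -
  define e where "e l j = exp (- (\<rho> * (real d * (real N * (real j - real l))\<^sup>2)))" for l j :: nat
  have \<alpha>: "\<alpha> = (\<Sum>l<N. \<Sum>j<N. e l j) / (real N)\<^sup>2" by (simp add: \<alpha>_def e_def)
  show "0 \<le> \<alpha>" by (simp add: \<alpha> e_def sum_nonneg)
  have "(\<Sum>l<N. \<Sum>j<N. e l j) \<le> (\<Sum>l<N. \<Sum>j<N. 1)"
    using assms(1-3) by (intro sum_mono) (simp add: e_def)
  then show "\<alpha> \<le> 1" using assms(3) by (simp add: \<alpha> power2_eq_square)
  have "e l j \<le> of_bool (j = l) + exp (- (\<rho> * real N))" for l j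
  proof (cases "j = l")
    case False
    have "j + 1 \<le> l \<or> l + 1 \<le> j" using False by linarith
    then have "1 \<le> \<bar>real j - real l\<bar>" by auto
    then have "1 \<le> (real j - real l)\<^sup>2"
      by (metis abs_le_square_iff abs_one one_power2)
    moreover have "real N \<le> real d * (real N)\<^sup>2"
      using assms(1-3) mult_mono[of 1 "real d" "real N" "(real N)\<^sup>2"] by (simp add: power2_eq_square)
    ultimately have "real N \<le> real d * (real N)\<^sup>2 * (real j - real l)\<^sup>2"
      using mult_mono[of "real N" "real d * (real N)\<^sup>2" 1 "(real j - real l)\<^sup>2"] by simp
    then have "\<rho> * real N \<le> \<rho> * (real d * (real N * (real j - real l))\<^sup>2)"
      using assms(1-3) by (intro mult_left_mono) (simp_all add: power_mult_distrib mult_ac)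
    then show ?thesis using False by (simp add: e_def)
  qed (simp add: e_def)
  then have "(\<Sum>l<N. \<Sum>j<N. e l j) \<le> (\<Sum>l<N. \<Sum>j<N. of_bool (j = l) + exp (- (\<rho> * real N)))"
    by (intro sum_mono)
  also have "\<dots> = real N + (real N)\<^sup>2 * exp (- (\<rho> * real N))"
    by (simp add: sum.distrib power2_eq_square algebra_simps of_bool_def)
  finally show "\<alpha> \<le> 1 / real N + exp (- (\<rho> * real N))"
    using assms(3) by (simp add: \<alpha> field_simps power2_eq_square)
qed

text \<open>
  The hypothesis on \<open>g\<close> is tested on spread measures. Spreading leaves the form of \<open>\<psi> F\<close> unchanged
  and annihilates the forms of the other Bernstein terms; the form of the integral tends to zero,
  because every parameter that \<open>\<eta>\<close> charges has a positive coordinate outside \<open>F\<close>.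
\<close>

lemma bernstein_term_nonneg:
  assumes k: "0 < k" "k \<le> n" and pdi: "PDI k n g"
    and \<eta>: "space \<eta> = orthant {1..n} - bdry (k + 1) {1..n}"
    and int: "\<And>t. t \<in> orthant {1..n} \<Longrightarrow> integrable \<eta> (mid_kernel k n t)"
    and rep: "\<And>t. t \<in> orthant {1..n} \<Longrightarrow> g t =
      (\<Sum>F | F \<subseteq> {1..n} \<and> card F = k. \<psi> F (restrict t F)) + (\<integral>r. mid_kernel k n t r \<partial>\<eta>)"
    and \<mu>: "\<mu> \<in> M_space k n (\<lambda>_. Rd d)" and F: "F \<subseteq> {1..n}" "card F = k"
  shows "0 \<le> qform \<mu> (\<lambda>u v. (-1) ^ k * \<psi> F (restrict (sqdists n d u v) F))"
proof (cases "d = 0")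
  \<comment> \<open>A single point carries no nonzero measure of total mass zero.\<close>
  case True
  have "qform \<mu> (\<lambda>u v. (-1) ^ k * \<psi> F (restrict (sqdists n d u v) F)) = 0"
  proof (rule qform_M_space_eq_0[OF \<mu> _ _ k(2), of "{}"])
    fix x y v assume "x \<in> (\<Pi>\<^sub>E i\<in>{1..n}. Rd d)" "y \<in> (\<Pi>\<^sub>E i\<in>{1..n}. Rd d)"
    moreover have "Rd d = {\<lambda>_. undefined}" using True by (simp add: Rd_def)
    ultimately have "x = y" by (intro PiE_ext[of x "{1..n}" "\<lambda>_. Rd d" y]) (auto simp: PiE_iff)
    then show "(-1) ^ k * \<psi> F (restrict (sqdists n d x v) F)
      = (-1) ^ k * \<psi> F (restrict (sqdists n d y v) F)" by simp
  qed (use k in auto)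
  then show ?thesis by simp
next
  case False
  note \<mu>d = M_space_discrete[OF \<mu>]
  have finF: "finite F" using F finite_subset by blast
  define B where "B = qform \<mu> (\<lambda>u v. (-1) ^ k * \<psi> F (restrict (sqdists n d u v) F))"
  define \<nu> where "\<nu> m = spread n d F (Suc m) \<mu>" for m
  have \<nu>: "\<nu> m \<in> M_space k n (\<lambda>_. Rd d)" for m
    unfolding \<nu>_def by (rule spread_M_space[OF \<mu> k(2)])
  define w where "w r = esym k n (\<lambda>i. r i + 1) / esym k n r
      * qform \<mu> (\<lambda>u v. exp (- (\<Sum>i\<in>F. r i * sqdists n d u v i)))" for r
  define \<alpha> where "\<alpha> m r = (\<Sum>l<Suc m. \<Sum>j<Suc m. exp (- (sum r ({1..n} - F)
      * (real d * (real (Suc m) * (real j - real l))\<^sup>2)))) / (real (Suc m))\<^sup>2" for m r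
  have ker: "qform (\<nu> m) (\<lambda>u v. (-1) ^ k * mid_kernel k n (sqdists n d u v) r) = \<alpha> m r * w r" for m r
    unfolding qform_mid_kernel[OF \<nu> k(2)] unfolding \<nu>_def gauss_qform_spread[OF \<mu>d F(1)]
    unfolding \<alpha>_def w_def by (rule mult.left_commute)
  have intw: "integrable \<eta> (\<lambda>r. \<alpha> m r * w r)" for m
    unfolding ker[symmetric]
    by (rule integrable_qform) (intro integrable_mult_right int sqdists_orthant)
  have psi: "qform (\<nu> m) (\<lambda>u v. (-1) ^ k * \<psi> F' (restrict (sqdists n d u v) F')) = (if F' = F then B else 0)"
    if F': "F' \<subseteq> {1..n}" "card F' = k" for m F'
  proof (cases "F' = F")
    case True
    have "restrict (sqdists n d (spread_point n d F N j u) (spread_point n d F N l v)) F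
        = restrict (sqdists n d u v) F" for N j l u v
      using F(1) by (intro restrict_ext) (auto simp: sqdists_spread_point)
    then show ?thesis
      using True by (simp add: \<nu>_def qform_spread[OF \<mu>d] B_def power2_eq_square)
  next
    case False
    have "F' \<inter> F \<noteq> F'" using False F F' finF by (metis card_subset_eq inf_le2)
    then have "card (F' \<inter> F) < k"
      using F' psubset_card_mono[of F' "F' \<inter> F"] finite_subset[OF F'(1)] by auto
    then have "qform \<mu> (\<lambda>u v. (-1) ^ k * \<psi> F' (restrict (sqdists n d
        (spread_point n d F N j u) (spread_point n d F N l v)) F')) = 0" for N j l
    proof (rule qform_M_space_eq_0[OF \<mu> _ _ k(2), rotated])
      fix x y v :: "nat \<Rightarrow> nat \<Rightarrow> real" assume xy: "\<forall>i\<in>F' \<inter> F. x i = y i"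
      have "restrict (sqdists n d (spread_point n d F N j x) (spread_point n d F N l v)) F'
          = restrict (sqdists n d (spread_point n d F N j y) (spread_point n d F N l v)) F'"
        using F'(1) xy by (intro restrict_ext) (auto simp: sqdists_def spread_point_def)
      then show "(-1) ^ k * \<psi> F' (restrict (sqdists n d (spread_point n d F N j x) (spread_point n d F N l v)) F')
        = (-1) ^ k * \<psi> F' (restrict (sqdists n d (spread_point n d F N j y) (spread_point n d F N l v)) F')"
        by simp
    qed (use F' in auto)
    then show ?thesis using False by (simp add: \<nu>_def qform_spread[OF \<mu>d])
  qed
  have "0 \<le> B + (\<integral>r. \<alpha> m r * w r \<partial>\<eta>)" for m
  proof -
    have "qform (\<nu> m) (\<lambda>u v. (-1) ^ k * (\<integral>r. mid_kernel k n (sqdists n d u v) r \<partial>\<eta>))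
        = (\<integral>r. qform (\<nu> m) (\<lambda>u v. (-1) ^ k * mid_kernel k n (sqdists n d u v) r) \<partial>\<eta>)"
      by (subst integral_qform) (auto intro!: integrable_mult_right int sqdists_orthant)
    moreover have "(\<Sum>F' | F' \<subseteq> {1..n} \<and> card F' = k.
        qform (\<nu> m) (\<lambda>u v. (-1) ^ k * \<psi> F' (restrict (sqdists n d u v) F'))) = B"
    proof -
      have "(\<Sum>F' | F' \<subseteq> {1..n} \<and> card F' = k.
          qform (\<nu> m) (\<lambda>u v. (-1) ^ k * \<psi> F' (restrict (sqdists n d u v) F')))
          = (\<Sum>F' | F' \<subseteq> {1..n} \<and> card F' = k. if F' = F then B else 0)"
        by (intro sum.cong refl psi) auto
      also have "\<dots> = B" using F by (subst sum.delta) auto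
      finally show ?thesis .
    qed
    moreover have "0 \<le> qform (\<nu> m) (\<lambda>u v. (-1) ^ k * g (sqdists n d u v))"
      using pdi \<nu> by (auto simp: PDI_qform)
    ultimately show ?thesis
      by (simp only: rep[OF sqdists_orthant] distrib_left qform_add qform_sum sum_distrib_left ker)
  qed
  moreover have "(\<lambda>m. \<integral>r. \<alpha> m r * w r \<partial>\<eta>) \<longlonglongrightarrow> (\<integral>r. 0 \<partial>\<eta>)"
  proof (rule integral_dominated_convergence)
    \<comment> \<open>The measure spread over a single point provides the dominating function.\<close>
    have \<alpha>0: "\<alpha> 0 r = 1" for r by (simp add: \<alpha>_def)
    then have w: "integrable \<eta> w" using intw[of 0] by simp
    then show "integrable \<eta> (\<lambda>r. \<bar>w r\<bar>)" by simp
    have pos: "0 < sum r ({1..n} - F)" if "r \<in> space \<eta>" for r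
    proof -
      have r: "r \<in> orthant {1..n}" "\<not> card {i \<in> {1..n}. 0 < r i} < k + 1"
        using that \<eta> by (auto simp: bdry_def)
      have "\<not> {i \<in> {1..n}. 0 < r i} \<subseteq> F"
      proof
        assume "{i \<in> {1..n}. 0 < r i} \<subseteq> F"
        from card_mono[OF finF this] r(2) F(2) show False by linarith
      qed
      then obtain i where "i \<in> {1..n} - F" "0 < r i" by auto
      then show ?thesis using orthant_D[OF r(1)] by (intro sum_pos2[of _ i]) auto
    qed
    have bd: "0 \<le> \<alpha> m r" "\<alpha> m r \<le> 1"
      "\<alpha> m r \<le> 1 / real (Suc m) + exp (- (sum r ({1..n} - F) * real (Suc m)))"
      if "r \<in> space \<eta>" for m r
      unfolding \<alpha>_def using pos[OF that] False
      by (intro spread_average_bounds; simp)+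
    show "AE r in \<eta>. norm (\<alpha> m r * w r) \<le> \<bar>w r\<bar>" for m
      using bd by (intro AE_I2) (simp add: abs_mult mult_left_le_one_le)
    show "AE r in \<eta>. (\<lambda>m. \<alpha> m r * w r) \<longlonglongrightarrow> 0"
    proof (rule AE_I2)
      fix r assume r: "r \<in> space \<eta>"
      have "exp (- (sum r ({1..n} - F) * real m)) = exp (- sum r ({1..n} - F)) ^ m" for m
        by (simp add: exp_of_nat_mult[symmetric] mult.commute)
      moreover have "(\<lambda>m. exp (- sum r ({1..n} - F)) ^ m) \<longlonglongrightarrow> 0"
        using pos[OF r] by (intro LIMSEQ_power_zero) simp
      ultimately have "(\<lambda>m. 1 / real m + exp (- (sum r ({1..n} - F) * real m))) \<longlonglongrightarrow> 0 + 0"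
        by (intro tendsto_add lim_1_over_n) (simp only:)
      then have "(\<lambda>m. 1 / real m + exp (- (sum r ({1..n} - F) * real m))) \<longlonglongrightarrow> 0" by simp
      then have "(\<lambda>m. 1 / real (Suc m) + exp (- (sum r ({1..n} - F) * real (Suc m)))) \<longlonglongrightarrow> 0"
        by (rule LIMSEQ_Suc)
      then have "(\<lambda>m. \<alpha> m r) \<longlonglongrightarrow> 0"
        by (rule tendsto_sandwich[OF always_eventually always_eventually tendsto_const, rotated 2])
          (intro allI bd[OF r])+
      then show "(\<lambda>m. \<alpha> m r * w r) \<longlonglongrightarrow> 0" by (rule tendsto_mult_left_zero)
    qed
  qed (use intw in auto)
  then have "(\<lambda>m. B + (\<integral>r. \<alpha> m r * w r \<partial>\<eta>)) \<longlonglongrightarrow> B + 0" by (intro tendsto_add) simp_all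
  ultimately show ?thesis unfolding B_def[symmetric] by (simp add: LIMSEQ_le_const)
qed


section \<open>The three forms of the representation\<close>

lemma boundary_zero_coordinate:
  assumes "r \<in> orthant {1..n} - open_orthant {1..n}"
  obtains i where "i \<in> {1..n}" "r i = 0"
  using assms by (auto simp: orthant_def open_orthant_def PiE_iff less_le)

lemma open_orthant_subset: "open_orthant I \<subseteq> orthant I"
  by (auto simp: orthant_def open_orthant_def intro!: PiE_mono)

text \<open>
  In each form of the representation the quadratic form of \<open>(-1) ^ k\<close> times the kernel is a positive
  multiple of the Gaussian form for parameters in the open orthant, and vanishes on the witness for all
  other parameters. The witness lies in the smallest of the spaces, with \<open>k = n\<close>, so the Bernstein
  terms, which depend on fewer than \<open>n\<close> coordinates, vanish on it too.
\<close>

lemma strictness_dichotomy: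
  assumes "k \<le> n" and pdi: "PDI k n g" and \<eta>: "representing_measure k n g \<eta>"
  shows "0 < measure \<eta> (open_orthant {1..n}) \<Longrightarrow> SPDI k n g"
    and "measure \<eta> (open_orthant {1..n}) = 0 \<Longrightarrow>
      qform (witness n) (\<lambda>u v. g (sqdists n 1 u v)) = 0"
proof -
  consider (zero) "k = 0" | (full) "k \<noteq> 0" "k = n" | (mid) "k \<noteq> 0" "k < n"
    using \<open>k \<le> n\<close> by linarith
  then have "(0 < measure \<eta> (open_orthant {1..n}) \<longrightarrow> SPDI k n g) \<and>
    (measure \<eta> (open_orthant {1..n}) = 0 \<longrightarrow> qform (witness n) (\<lambda>u v. g (sqdists n 1 u v)) = 0)"
  proof cases
    case zero
    define \<kappa> where "\<kappa> t r = exp (- (\<Sum>i=1..n. r i * t i))" for t r :: "nat \<Rightarrow> real"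
    have fin: "finite_borel_measure_on n (orthant {1..n}) \<eta>"
      and int: "\<And>t. t \<in> orthant {1..n} \<Longrightarrow> integrable \<eta> (\<kappa> t)"
      and rep: "\<And>t. t \<in> orthant {1..n} \<Longrightarrow> g t = (\<lambda>_. 0) t + (\<integral>r. \<kappa> t r \<partial>\<eta>)"
      using \<eta> zero by (simp_all add: representing_measure_def represents_zero_def \<kappa>_def[abs_def])
    have \<kappa>: "qform \<mu> (\<lambda>u v. (-1) ^ k * \<kappa> (sqdists n d u v) r) = gauss_qform n d \<mu> r" for d \<mu> r
      using zero by (simp add: \<kappa>_def gauss_qform_def)
    show ?thesis
    proof (intro conjI impI)
      assume pos: "0 < measure \<eta> (open_orthant {1..n})"
      show "SPDI k n g"
      proof (rule SPDI_if_open_orthant_charged[OF fin open_orthant_subset order_refl int rep pdi pos])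
        fix d \<mu> r assume "\<mu> \<in> M_space k n (\<lambda>_. Rd d)"
        note \<mu> = M_space_discrete[OF this]
        show "0 \<le> qform \<mu> (\<lambda>u v. (-1) ^ k * \<kappa> (sqdists n d u v) r)" if "r \<in> orthant {1..n}"
          unfolding \<kappa> by (rule gauss_qform_nonneg[OF \<mu> orthant_D[OF that]])
        show "0 < qform \<mu> (\<lambda>u v. (-1) ^ k * \<kappa> (sqdists n d u v) r)"
          if "r \<in> open_orthant {1..n}" "\<mu> \<noteq> (\<lambda>_. 0)"
          unfolding \<kappa> by (rule gauss_qform_pos[OF \<mu> that])
      qed (auto simp: qform_def dint_def simp del: One_nat_def)
    next
      assume null: "measure \<eta> (open_orthant {1..n}) = 0"
      show "qform (witness n) (\<lambda>u v. g (sqdists n 1 u v)) = 0"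
      proof (rule form_zero_if_open_orthant_null[OF fin open_orthant_subset order_refl int rep null])
        fix r assume "r \<in> orthant {1..n} - open_orthant {1..n}"
        then obtain i where "i \<in> {1..n}" "r i = 0" by (rule boundary_zero_coordinate)
        then have "gauss_qform n 1 (witness n) r = 0" by (rule witness_gauss_qform)
        then show "qform (witness n) (\<lambda>u v. \<kappa> (sqdists n 1 u v) r) = 0"
          by (simp only: \<kappa>_def gauss_qform_def)
      qed (auto simp: qform_def dint_def simp del: One_nat_def)
    qed
  next
    case full
    define \<kappa> where "\<kappa> t r = (\<Prod>i=1..n. bern_factor (r i) (t i))" for t r :: "nat \<Rightarrow> real"
    have fin: "finite_borel_measure_on n (orthant {1..n}) \<eta>"
      and int: "\<And>t. t \<in> orthant {1..n} \<Longrightarrow> integrable \<eta> (\<kappa> t)"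
      and rep: "\<And>t. t \<in> orthant {1..n} \<Longrightarrow> g t = (\<lambda>_. 0) t + (\<integral>r. \<kappa> t r \<partial>\<eta>)"
      using \<eta> full by (simp_all add: representing_measure_def represents_full_def \<kappa>_def[abs_def])
    show ?thesis
    proof (intro conjI impI)
      assume pos: "0 < measure \<eta> (open_orthant {1..n})"
      show "SPDI k n g"
      proof (rule SPDI_if_open_orthant_charged[OF fin open_orthant_subset order_refl int rep pdi pos])
        fix d \<mu> r assume \<mu>: "\<mu> \<in> M_space k n (\<lambda>_. Rd d)"
        then have \<mu>n: "\<mu> \<in> M_space n n (\<lambda>_. Rd d)" using full by simp
        show "0 \<le> qform \<mu> (\<lambda>u v. (-1) ^ k * \<kappa> (sqdists n d u v) r)" if "r \<in> orthant {1..n}"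
          unfolding \<kappa>_def full(2) by (rule qform_full_kernel_nonneg[OF \<mu>n that])
        assume r: "r \<in> open_orthant {1..n}" "\<mu> \<noteq> (\<lambda>_. 0)"
        have "0 < (\<Prod>i=1..n. (1 + r i) / r i)"
          using open_orthant_D[OF r(1)] by (intro prod_pos) (simp add: add_pos_pos)
        then show "0 < qform \<mu> (\<lambda>u v. (-1) ^ k * \<kappa> (sqdists n d u v) r)"
          unfolding \<kappa>_def full(2) qform_full_kernel[OF \<mu>n r(1)]
          using gauss_qform_pos[OF M_space_discrete[OF \<mu>] r] by (rule mult_pos_pos)
      qed (auto simp: qform_def dint_def simp del: One_nat_def)
    next
      assume null: "measure \<eta> (open_orthant {1..n}) = 0"
      show "qform (witness n) (\<lambda>u v. g (sqdists n 1 u v)) = 0"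
      proof (rule form_zero_if_open_orthant_null[OF fin open_orthant_subset order_refl int rep null])
        fix r assume "r \<in> orthant {1..n} - open_orthant {1..n}"
        then obtain i where "i \<in> {1..n}" "r i = 0" by (rule boundary_zero_coordinate)
        then show "qform (witness n) (\<lambda>u v. \<kappa> (sqdists n 1 u v) r) = 0"
          unfolding \<kappa>_def by (rule witness_full_kernel)
      qed (auto simp: qform_def dint_def simp del: One_nat_def)
    qed
  next
    case mid
    define \<Omega> where "\<Omega> = orthant {1..n} - bdry (k + 1) {1..n}"
    from \<eta> mid obtain \<psi> :: "nat set \<Rightarrow> (nat \<Rightarrow> real) \<Rightarrow> real"
      where fin: "finite_borel_measure_on n \<Omega> \<eta>"
        and int: "\<And>t. t \<in> orthant {1..n} \<Longrightarrow> integrable \<eta> (mid_kernel k n t)"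
        and rep: "\<And>t. t \<in> orthant {1..n} \<Longrightarrow> g t =
          (\<Sum>F | F \<subseteq> {1..n} \<and> card F = k. \<psi> F (restrict t F)) + (\<integral>r. mid_kernel k n t r \<partial>\<eta>)"
      by (auto simp: representing_measure_def represents_mid_def \<Omega>_def)
    have \<Omega>: "open_orthant {1..n} \<subseteq> \<Omega>" "\<Omega> \<subseteq> orthant {1..n}"
    proof -
      have "card {i \<in> {1..n}. 0 < r i} = n" if "r \<in> open_orthant {1..n}" for r
      proof -
        have "{i \<in> {1..n}. 0 < r i} = {1..n}" using open_orthant_D[OF that] by auto
        then show ?thesis by simp
      qed
      then show "open_orthant {1..n} \<subseteq> \<Omega>"
        using open_orthant_subset mid by (force simp: \<Omega>_def bdry_def)
    qed (simp add: \<Omega>_def)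
    have sp: "space \<eta> = orthant {1..n} - bdry (k + 1) {1..n}"
      using finite_borel_measure_on_space[OF fin \<Omega>(2)] by (simp add: \<Omega>_def)
    show ?thesis
    proof (intro conjI impI)
      assume pos: "0 < measure \<eta> (open_orthant {1..n})"
      show "SPDI k n g"
      proof (rule SPDI_if_open_orthant_charged[OF fin \<Omega> int rep pdi pos])
        fix d \<mu> assume \<mu>: "\<mu> \<in> M_space k n (\<lambda>_. Rd d)"
        show "0 \<le> qform \<mu> (\<lambda>u v. (-1) ^ k * (\<Sum>F | F \<subseteq> {1..n} \<and> card F = k. \<psi> F (restrict (sqdists n d u v) F)))"
          unfolding sum_distrib_left qform_sum
        proof (rule sum_nonneg)
          fix F assume "F \<in> {F. F \<subseteq> {1..n} \<and> card F = k}"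
          then show "0 \<le> qform \<mu> (\<lambda>u v. (-1) ^ k * \<psi> F (restrict (sqdists n d u v) F))"
            using mid by (intro bernstein_term_nonneg[OF _ _ pdi sp int rep \<mu>]) auto
        qed
        fix r
        show "0 \<le> qform \<mu> (\<lambda>u v. (-1) ^ k * mid_kernel k n (sqdists n d u v) r)" if "r \<in> \<Omega>"
        proof -
          have r0: "0 \<le> r i" if "i \<in> {1..n}" for i using \<open>r \<in> \<Omega>\<close> \<Omega>(2) that orthant_D by blast
          then show ?thesis
            unfolding qform_mid_kernel[OF \<mu> \<open>k \<le> n\<close>]
            by (intro mult_nonneg_nonneg divide_nonneg_nonneg esym_nonneg
                gauss_qform_nonneg[OF M_space_discrete[OF \<mu>]]) (auto simp del: One_nat_def)
        qed
        assume r: "r \<in> open_orthant {1..n}" "\<mu> \<noteq> (\<lambda>_. 0)"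
        have "0 < esym k n (\<lambda>i. r i + 1) / esym k n r"
          using open_orthant_D[OF r(1)] \<open>k \<le> n\<close>
          by (intro divide_pos_pos esym_pos) (auto simp: add_pos_pos simp del: One_nat_def)
        then show "0 < qform \<mu> (\<lambda>u v. (-1) ^ k * mid_kernel k n (sqdists n d u v) r)"
          unfolding qform_mid_kernel[OF \<mu> \<open>k \<le> n\<close>]
          using gauss_qform_pos[OF M_space_discrete[OF \<mu>] r] by (rule mult_pos_pos)
      qed
    next
      assume null: "measure \<eta> (open_orthant {1..n}) = 0"
      show "qform (witness n) (\<lambda>u v. g (sqdists n 1 u v)) = 0"
      proof (rule form_zero_if_open_orthant_null[OF fin \<Omega> int rep null])
        show "qform (witness n) (\<lambda>u v. \<Sum>F | F \<subseteq> {1..n} \<and> card F = k. \<psi> F (restrict (sqdists n 1 u v) F)) = 0"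
          unfolding qform_sum
        proof (rule sum.neutral, safe)
          fix F assume F: "F \<subseteq> {1..n}" "k = card F"
          show "qform (witness n) (\<lambda>u v. \<psi> F (restrict (sqdists n 1 u v) F)) = 0"
          proof (rule qform_M_space_eq_0[OF witness_M_space F(1) _ order_refl])
            fix x y v :: "nat \<Rightarrow> nat \<Rightarrow> real" assume "\<forall>i\<in>F. x i = y i"
            then have "restrict (sqdists n 1 x v) F = restrict (sqdists n 1 y v) F"
              by (intro restrict_ext) (auto simp: sqdists_def)
            then show "\<psi> F (restrict (sqdists n 1 x v) F) = \<psi> F (restrict (sqdists n 1 y v) F)"
              by simp
          qed (use F mid in auto)
        qed
        fix r assume "r \<in> \<Omega> - open_orthant {1..n}"
        then have "r \<in> orthant {1..n} - open_orthant {1..n}" using \<Omega>(2) by blast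
        then obtain i where "i \<in> {1..n}" "r i = 0" by (rule boundary_zero_coordinate)
        then have "gauss_qform n 1 (witness n) r = 0" by (rule witness_gauss_qform)
        then have "(-1) ^ k * qform (witness n) (\<lambda>u v. mid_kernel k n (sqdists n 1 u v) r) = 0"
          using qform_mid_kernel[OF M_space_mono[OF witness_M_space \<open>k \<le> n\<close> order_refl] \<open>k \<le> n\<close>, of r]
          by (simp add: qform_mult)
        then show "qform (witness n) (\<lambda>u v. mid_kernel k n (sqdists n 1 u v) r) = 0" by simp
      qed
    qed
  qed
  then show "0 < measure \<eta> (open_orthant {1..n}) \<Longrightarrow> SPDI k n g"
    and "measure \<eta> (open_orthant {1..n}) = 0 \<Longrightarrow>
      qform (witness n) (\<lambda>u v. g (sqdists n 1 u v)) = 0" by simp_all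
qed


section \<open>Products of marginals over the blocks of a partition\<close>

text \<open>
  Draw a point for each block independently from \<open>P\<close> and glue their restrictions to the blocks.
\<close>

lemma block_product_eq_point_masses:
  assumes P: "discrete_measure (Pi\<^sub>E I X) P" and I: "\<Union>\<pi> = I" "finite I" and dis: "disjoint \<pi>"
  shows "block_product \<pi> P = point_masses (\<Pi>\<^sub>E B\<in>\<pi>. {x. P x \<noteq> 0})
    (\<lambda>y. \<Prod>B\<in>\<pi>. P (y B)) (\<lambda>y. \<lambda>i\<in>I. y (THE B. B \<in> \<pi> \<and> i \<in> B) i)"
proof
  fix x
  define S where "S = {x. P x \<noteq> 0}"
  have finS: "finite S" using P by (simp add: S_def discrete_measure_def)
  have fin\<pi>: "finite \<pi>" using I by (metis finite_UnionD)
  define glue where "glue y = (\<lambda>i\<in>I. y (THE B. B \<in> \<pi> \<and> i \<in> B) i)" for y :: "nat set \<Rightarrow> nat \<Rightarrow> 'a"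
  have block: "(THE B. B \<in> \<pi> \<and> i \<in> B) = B" if "B \<in> \<pi>" "i \<in> B" for i B
    using that dis by (intro the_equality) (auto simp: disjoint_def)
  show "block_product \<pi> P x = point_masses (\<Pi>\<^sub>E B\<in>\<pi>. {x. P x \<noteq> 0})
    (\<lambda>y. \<Prod>B\<in>\<pi>. P (y B)) (\<lambda>y. \<lambda>i\<in>I. y (THE B. B \<in> \<pi> \<and> i \<in> B) i) x"
    unfolding S_def[symmetric] glue_def[symmetric]
  proof (cases "x \<in> extensional I")
    case False
    have "glue y \<noteq> x" for y using False by (auto simp: glue_def)
    then show "block_product \<pi> P x = point_masses (\<Pi>\<^sub>E B\<in>\<pi>. S) (\<lambda>y. \<Prod>B\<in>\<pi>. P (y B)) glue x"
      using False I by (simp add: block_product_def point_masses_def)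
  next
    case True
    have glue: "glue y = x \<longleftrightarrow> (\<forall>B\<in>\<pi>. restrict (y B) B = restrict x B)" for y
    proof
      assume "glue y = x"
      show "\<forall>B\<in>\<pi>. restrict (y B) B = restrict x B"
      proof (intro ballI restrict_ext)
        fix B i assume "B \<in> \<pi>" "i \<in> B"
        moreover from this have "i \<in> I" using I by auto
        ultimately show "y B i = x i" using \<open>glue y = x\<close> by (auto simp: glue_def block)
      qed
    next
      assume eq: "\<forall>B\<in>\<pi>. restrict (y B) B = restrict x B"
      show "glue y = x"
      proof
        fix i
        show "glue y i = x i"
        proof (cases "i \<in> I")
          case i: True
          then obtain B where B: "B \<in> \<pi>" "i \<in> B" using I by auto
          then have "restrict (y B) B i = restrict x B i" using eq by simp
          then show ?thesis using B i by (simp add: glue_def block)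
        qed (use True in \<open>simp add: glue_def extensional_def\<close>)
      qed
    qed
    have "block_product \<pi> P x = (\<Prod>B\<in>\<pi>. marginal B P (restrict x B))"
      using True I by (simp add: block_product_def)
    also have "\<dots> = (\<Prod>B\<in>\<pi>. \<Sum>z\<in>S. of_bool (restrict z B = restrict x B) * P z)"
    proof (rule prod.cong[OF refl])
      fix B
      show "marginal B P (restrict x B) = (\<Sum>z\<in>S. of_bool (restrict z B = restrict x B) * P z)"
        unfolding marginal_def using finS
        by (subst dmass_eq_dint) (simp_all add: S_def dint_def)
    qed
    also have "\<dots> = (\<Sum>y\<in>(\<Pi>\<^sub>E B\<in>\<pi>. S). \<Prod>B\<in>\<pi>. of_bool (restrict (y B) B = restrict x B) * P (y B))"
      using fin\<pi> finS by (intro prod_sum_PiE) auto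
    also have "\<dots> = (\<Sum>y\<in>(\<Pi>\<^sub>E B\<in>\<pi>. S). if glue y = x then \<Prod>B\<in>\<pi>. P (y B) else 0)"
      by (intro sum.cong refl) (simp add: prod.distrib prod_of_bool[OF fin\<pi>] glue)
    also have "\<dots> = point_masses (\<Pi>\<^sub>E B\<in>\<pi>. S) (\<lambda>y. \<Prod>B\<in>\<pi>. P (y B)) glue x"
      using fin\<pi> finS by (simp add: point_masses_def sum.inter_filter finite_PiE)
    finally show "block_product \<pi> P x = point_masses (\<Pi>\<^sub>E B\<in>\<pi>. S) (\<lambda>y. \<Prod>B\<in>\<pi>. P (y B)) glue x" .
  qed
qed

lemma dint_block_product:
  assumes P: "discrete_measure (Pi\<^sub>E I X) P" and I: "\<Union>\<pi> = I" "finite I" and dis: "disjoint \<pi>"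
    and G: "G \<subseteq> I"
  shows "dint (block_product \<pi> P) (\<lambda>x. \<Prod>i\<in>G. f i (x i)) = (\<Prod>B\<in>\<pi>. dint P (\<lambda>x. \<Prod>i\<in>G \<inter> B. f i (x i)))"
proof -
  define S where "S = {x. P x \<noteq> 0}"
  have finS: "finite S" using P by (simp add: S_def discrete_measure_def)
  have fin\<pi>: "finite \<pi>" using I by (metis finite_UnionD)
  define glue where "glue y = (\<lambda>i\<in>I. y (THE B. B \<in> \<pi> \<and> i \<in> B) i)" for y :: "nat set \<Rightarrow> nat \<Rightarrow> 'a"
  have block: "(THE B. B \<in> \<pi> \<and> i \<in> B) = B" if "B \<in> \<pi>" "i \<in> B" for i B
    using that dis by (intro the_equality) (auto simp: disjoint_def)
  have split: "(\<Prod>i\<in>G. f i (glue y i)) = (\<Prod>B\<in>\<pi>. \<Prod>i\<in>G \<inter> B. f i (y B i))" for y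
  proof -
    have "G = (\<Union>B\<in>\<pi>. G \<inter> B)" using G I by auto
    then have "(\<Prod>i\<in>G. f i (glue y i)) = (\<Prod>i\<in>(\<Union>B\<in>\<pi>. G \<inter> B). f i (glue y i))" by simp
    also have "\<dots> = (\<Prod>B\<in>\<pi>. \<Prod>i\<in>G \<inter> B. f i (glue y i))"
      using fin\<pi> finite_subset[OF G I(2)] dis
      by (intro prod.UNION_disjoint) (auto simp: disjoint_def)
    also have "\<dots> = (\<Prod>B\<in>\<pi>. \<Prod>i\<in>G \<inter> B. f i (y B i))"
      using G by (intro prod.cong refl) (auto simp: glue_def block)
    finally show ?thesis .
  qed
  have "dint (block_product \<pi> P) (\<lambda>x. \<Prod>i\<in>G. f i (x i))
      = (\<Sum>y\<in>(\<Pi>\<^sub>E B\<in>\<pi>. S). (\<Prod>i\<in>G. f i (glue y i)) * (\<Prod>B\<in>\<pi>. P (y B)))"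
    unfolding block_product_eq_point_masses[OF P I dis] S_def[symmetric] glue_def[symmetric]
    using fin\<pi> finS by (simp add: dint_point_masses finite_PiE)
  also have "\<dots> = (\<Sum>y\<in>(\<Pi>\<^sub>E B\<in>\<pi>. S). \<Prod>B\<in>\<pi>. (\<Prod>i\<in>G \<inter> B. f i (y B i)) * P (y B))"
    by (simp add: split prod.distrib)
  also have "\<dots> = (\<Prod>B\<in>\<pi>. \<Sum>x\<in>S. (\<Prod>i\<in>G \<inter> B. f i (x i)) * P x)"
    using fin\<pi> finS by (intro prod_sum_PiE[symmetric]) auto
  finally show ?thesis by (simp add: dint_def S_def)
qed

lemma discrete_prob_dint_1:
  assumes "discrete_prob S P"
  shows "discrete_measure S P" "dint P (\<lambda>_. 1) = 1"
proof -
  show P: "discrete_measure S P" using assms by (simp add: discrete_prob_def)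
  have "dint P (\<lambda>x. of_bool (x \<in> S)) = dint P (\<lambda>_. 1)"
    using P by (intro dint_cong) (auto simp: discrete_measure_def)
  then show "dint P (\<lambda>_. 1) = 1"
    using assms P dmass_eq_dint[of P S] by (simp add: discrete_prob_def discrete_measure_def)
qed


section \<open>The Lancaster interaction has vanishing marginals\<close>

text \<open>
  This is an \<open>N\<close>-th finite difference of a polynomial of degree \<open>q\<close>; a first difference lowers both
  \<open>N\<close> and \<open>q\<close> by one.
\<close>

lemma alternating_sum_gbinomial:
  fixes a :: real
  assumes "q < N"
  shows "(\<Sum>l\<le>N. (-1) ^ l * real (N choose l) * ((a - real l) gchoose q)) = 0"
  using assms
proof (induction N arbitrary: a q)
  case (Suc N)
  define f where "f l = ((a - real l) gchoose q)" for l :: nat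
  have "(\<Sum>l\<le>Suc N. (-1) ^ l * real (Suc N choose l) * f l)
      = f 0 + (\<Sum>l\<le>N. (-1) ^ Suc l * real (N choose l) * f (Suc l))
        + (\<Sum>l\<le>N. (-1) ^ Suc l * real (N choose Suc l) * f (Suc l))"
    by (simp add: sum.atMost_Suc_shift sum.distrib[symmetric] algebra_simps del: sum.atMost_Suc)
  also have "f 0 + (\<Sum>l\<le>N. (-1) ^ Suc l * real (N choose l) * f (Suc l))
        + (\<Sum>l\<le>N. (-1) ^ Suc l * real (N choose Suc l) * f (Suc l))
      = (\<Sum>l\<le>N. (-1) ^ Suc l * real (N choose l) * f (Suc l))
        + (\<Sum>l\<le>Suc N. (-1) ^ l * real (N choose l) * f l)"
    by (simp add: sum.atMost_Suc_shift del: sum.atMost_Suc)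
  also have "\<dots> = (\<Sum>l\<le>N. (-1) ^ l * real (N choose l) * (f l - f (Suc l)))"
    by (simp add: sum.distrib[symmetric] algebra_simps)
  also have "\<dots> = 0"
  proof (cases q)
    case 0
    then show ?thesis by (simp add: f_def)
  next
    case (Suc q')
    have "f l - f (Suc l) = ((a - 1) - real l) gchoose q'" for l
      using gbinomial_Suc_Suc[of "a - 1 - real l" q'] by (simp add: f_def Suc algebra_simps)
    then show ?thesis using Suc.IH[of q' "a - 1"] Suc Suc.prems by simp
  qed
  finally show ?case by (simp add: f_def)
qed simp

lemma sum_Pow_card:
  assumes "finite B"
  shows "(\<Sum>R\<in>Pow B. \<phi> (card R) :: real) = (\<Sum>l\<le>card B. real (card B choose l) * \<phi> l)"
proof -
  have "(\<Sum>R\<in>Pow B. \<phi> (card R)) = (\<Sum>l\<le>card B. \<Sum>R | R \<in> Pow B \<and> card R = l. \<phi> (card R))"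
    using assms by (intro sum.group[symmetric]) (auto intro: card_mono)
  also have "\<dots> = (\<Sum>l\<le>card B. real (card B choose l) * \<phi> l)"
    using assms by (intro sum.cong refl) (simp add: n_subsets)
  finally show ?thesis .
qed

text \<open>The coefficients of the interaction, continued by zero so that sums may run over all subsets.\<close>

definition lancaster_coeff :: "nat \<Rightarrow> nat \<Rightarrow> nat \<Rightarrow> real" where
  "lancaster_coeff k n j = (if j < k then (-1) ^ (k - j) * real ((n - j - 1) choose (n - k)) else 0)"

text \<open>
  Up to sign the coefficient of index \<open>j\<close> is the polynomial \<open>(n - 1 - j) gchoose (n - k)\<close>, which
  vanishes for \<open>k \<le> j < n\<close>. Its full alternating sums vanish because its degree is too small; only
  when \<open>s = m\<close> does the sum reach the index \<open>j = n\<close>, where the polynomial and the coefficient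
  differ.
\<close>

lemma sum_lancaster_coeff:
  assumes "s \<le> m" "m < k" "k \<le> n"
  shows "(\<Sum>l\<le>n - m. real (n - m choose l) * lancaster_coeff k n (s + l)) = - of_bool (s = m)"
proof -
  define p where "p l = ((real (n - 1 - s) - real l) gchoose (n - k))" for l
  \<comment> \<open>At \<open>s + l = n\<close> the polynomial takes the value \<open>-1 gchoose (n - k) = (-1) ^ (n - k)\<close>.\<close>
  have coeff: "lancaster_coeff k n (s + l) = (-1) ^ (k + s) * (-1) ^ l * p l - of_bool (s = m \<and> l = n - m)"
    if l: "l \<le> n - m" for l
  proof (cases "s + l = n")
    case True
    then have "s = m" "l = n - m" using assms l by linarith+
    moreover have "real (n - 1 - s) - real l = - 1"
      using True assms by (simp add: of_nat_diff)
    then have "p l = (-1) ^ (n - k)"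
      using gbinomial_negated_upper[of "-1 :: real" "n - k"]
      by (simp add: p_def binomial_gbinomial[symmetric])
    moreover have "(-1 :: real) ^ (k + s) * (-1) ^ l * (-1) ^ (n - k) = 1"
    proof -
      have "k + s + l + (n - k) = 2 * n" using True assms by linarith
      then show ?thesis by (metis power_add power_mult one_power2 power_one power2_minus)
    qed
    ultimately show ?thesis using True assms by (simp add: lancaster_coeff_def)
  next
    case False
    then have l': "s + l \<le> n - 1" "\<not> (s = m \<and> l = n - m)" using assms l by linarith+
    have "p l = real ((n - (s + l) - 1) choose (n - k))"
    proof -
      have "real (n - 1 - s) - real l = real (n - (s + l) - 1)"
        using l' by (simp add: of_nat_diff)
      then show ?thesis by (simp add: p_def binomial_gbinomial)
    qed
    moreover have "(-1 :: real) ^ (k - (s + l)) = (-1) ^ (k + s) * (-1) ^ l" if "s + l < k"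
      using that by (simp add: power_add[symmetric] uminus_power_if)
    moreover have "(n - (s + l) - 1) choose (n - k) = 0" if "\<not> s + l < k"
      using that l' assms by (intro binomial_eq_0) linarith
    ultimately show ?thesis using l'(2) by (auto simp: lancaster_coeff_def)
  qed
  have "(\<Sum>l\<le>n - m. real (n - m choose l) * lancaster_coeff k n (s + l))
      = (\<Sum>l\<le>n - m. (-1) ^ (k + s) * ((-1) ^ l * real (n - m choose l) * p l)
          - (if l = n - m then of_bool (s = m) else 0))"
  proof (rule sum.cong[OF refl])
    fix l assume "l \<in> {..n - m}"
    then have "l \<le> n - m" by simp
    then show "real (n - m choose l) * lancaster_coeff k n (s + l)
        = (-1) ^ (k + s) * ((-1) ^ l * real (n - m choose l) * p l)
          - (if l = n - m then of_bool (s = m) else 0)"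
      unfolding coeff[OF \<open>l \<le> n - m\<close>] by (auto simp: algebra_simps)
  qed
  also have "\<dots> = (-1) ^ (k + s) * (\<Sum>l\<le>n - m. (-1) ^ l * real (n - m choose l) * p l) - of_bool (s = m)"
    by (simp add: sum_subtractf sum_distrib_left)
  also have "\<dots> = - of_bool (s = m)"
    using assms by (simp add: p_def alternating_sum_gbinomial)
  finally show ?thesis .
qed

text \<open>
  Sorting the sets \<open>F\<close> by their trace \<open>S = F \<inter> G\<close> gives \<open>a S\<close> a coefficient that vanishes unless
  \<open>S = G\<close>.
\<close>

lemma lancaster_sum:
  fixes a :: "nat set \<Rightarrow> real"
  assumes G: "G \<subseteq> {1..n}" "card G < k" and "k \<le> n"
  shows "(\<Sum>j<k. (-1) ^ (k - j) * real ((n - j - 1) choose (n - k)) *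
    (\<Sum>F | F \<subseteq> {1..n} \<and> card F = j. a (F \<inter> G))) = - a G"
proof -
  have finG: "finite G" using G finite_subset by blast
  have "(\<Sum>j<k. (-1) ^ (k - j) * real ((n - j - 1) choose (n - k)) *
      (\<Sum>F | F \<subseteq> {1..n} \<and> card F = j. a (F \<inter> G)))
      = (\<Sum>j<k. \<Sum>F | F \<in> Pow {1..n} \<and> card F = j. lancaster_coeff k n (card F) * a (F \<inter> G))"
    by (auto simp: sum_distrib_left lancaster_coeff_def intro!: sum.cong)
  also have "\<dots> = (\<Sum>j\<le>n. \<Sum>F | F \<in> Pow {1..n} \<and> card F = j. lancaster_coeff k n (card F) * a (F \<inter> G))"
    using \<open>k \<le> n\<close> by (intro sum.mono_neutral_left) (auto simp: lancaster_coeff_def)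
  also have "\<dots> = (\<Sum>F\<in>Pow {1..n}. lancaster_coeff k n (card F) * a (F \<inter> G))"
  proof (rule sum.group)
    show "card ` Pow {1..n} \<subseteq> {..n}" using card_mono[of "{1..n}"] by auto
  qed auto
  also have "\<dots> = (\<Sum>(S, R)\<in>Pow G \<times> Pow ({1..n} - G). lancaster_coeff k n (card S + card R) * a S)"
  proof (rule sum.reindex_bij_witness[where i = "\<lambda>(S, R). S \<union> R" and j = "\<lambda>F. (F \<inter> G, F - G)"])
    fix F assume "F \<in> Pow {1..n}"
    then have "finite F" using finite_subset by auto
    then have "card F = card (F \<inter> G) + card (F - G)"
      by (subst card_Un_disjoint[symmetric]) (auto intro: arg_cong[where f = card])
    then show "(case (F \<inter> G, F - G) of (S, R) \<Rightarrow> lancaster_coeff k n (card S + card R) * a S)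
        = lancaster_coeff k n (card F) * a (F \<inter> G)"
      by simp
  qed (use G in auto)
  also have "\<dots> = (\<Sum>S\<in>Pow G. (\<Sum>R\<in>Pow ({1..n} - G). lancaster_coeff k n (card S + card R)) * a S)"
    by (simp add: sum.cartesian_product[symmetric] sum_distrib_right)
  also have "\<dots> = (\<Sum>S\<in>Pow G. if S = G then - a G else 0)"
  proof (rule sum.cong[OF refl])
    fix S assume S: "S \<in> Pow G"
    then have cS: "card S \<le> card G" "card S = card G \<longleftrightarrow> S = G"
      using S card_mono[OF finG, of S] card_subset_eq[OF finG, of S] by auto
    have "card ({1..n} - G) = n - card G" using G finG by (simp add: card_Diff_subset)
    then have "(\<Sum>R\<in>Pow ({1..n} - G). lancaster_coeff k n (card S + card R)) = - of_bool (card S = card G)"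
      by (simp add: sum_Pow_card[where \<phi> = "\<lambda>l. lancaster_coeff k n (card S + l)"]
          sum_lancaster_coeff[OF cS(1) G(2) \<open>k \<le> n\<close>] del: of_bool_eq_iff)
    then show "(\<Sum>R\<in>Pow ({1..n} - G). lancaster_coeff k n (card S + card R)) * a S = (if S = G then - a G else 0)"
      using cS(2) by simp
  qed
  also have "\<dots> = - a G" using finG by simp
  finally show ?thesis .
qed

lemma lancaster_blocks:
  assumes "F \<subseteq> {1..n}"
  shows "\<Union> (insert F ((\<lambda>i. {i}) ` ({1..n} - F))) = {1..n}"
    and "disjoint (insert F ((\<lambda>i. {i}) ` ({1..n} - F)))"
  using assms by (auto simp: disjoint_def)

lemma dint_lancaster:
  assumes P: "discrete_measure (Pi\<^sub>E {1..n} X) P"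
  shows "dint (lancaster k n P) f = dint P f +
    (\<Sum>j<k. (-1) ^ (k - j) * real ((n - j - 1) choose (n - k)) *
      (\<Sum>F | F \<subseteq> {1..n} \<and> card F = j.
        dint (block_product (insert F ((\<lambda>i. {i}) ` ({1..n} - F))) P) f))"
proof -
  note bp = discrete_measure_block_product[OF P]
  have bpF: "discrete_measure (Pi\<^sub>E {1..n} X) (block_product (insert F ((\<lambda>i. {i}) ` ({1..n} - F))) P)"
    if "F \<in> {F. F \<subseteq> {1..n} \<and> card F = j}" for F j
    using that by (intro bp lancaster_blocks) auto
  have summand: "discrete_measure (Pi\<^sub>E {1..n} X) (\<lambda>x. (-1) ^ (k - j) * real ((n - j - 1) choose (n - k)) *
      (\<Sum>F | F \<subseteq> {1..n} \<and> card F = j. block_product (insert F ((\<lambda>i. {i}) ` ({1..n} - F))) P x))" for j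
    by (intro discrete_measure_scale discrete_measure_sum bpF)
  show ?thesis
    unfolding lancaster_def[abs_def]
    by (simp only: dint_measure_add[OF P discrete_measure_sum[OF summand]] dint_measure_sum[OF summand]
        dint_measure_scale dint_measure_sum[OF bpF])
qed

text \<open>
  The mass of a cylinder over \<open>G\<close> under the product for \<open>F\<close> depends on \<open>F\<close> only through \<open>F \<inter> G\<close>, since
  coordinates outside \<open>G\<close> contribute factors \<open>1\<close>; so the sum cancels the mass under \<open>P\<close> itself.
\<close>

lemma lancaster_M_space:
  assumes P: "discrete_prob (Pi\<^sub>E {1..n} X) P" and "k \<le> n"
  shows "lancaster k n P \<in> M_space k n X"
proof (rule M_spaceI[OF _ \<open>k \<le> n\<close>])
  note Pd = discrete_prob_dint_1[OF P]
  show "discrete_measure (Pi\<^sub>E {1..n} X) (lancaster k n P)"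
    by (rule discrete_measure_lancaster[OF Pd(1)])
  fix G A assume G: "G \<subseteq> {1..n}" "card G < k"
  define p where "p S = dint P (\<lambda>x. \<Prod>i\<in>S. of_bool (x i \<in> A i))" for S
  define a where "a S = p S * (\<Prod>i\<in>G - S. p {i})" for S
  have "dint (block_product (insert F ((\<lambda>i. {i}) ` ({1..n} - F))) P) (\<lambda>x. \<Prod>i\<in>G. of_bool (x i \<in> A i))
      = a (F \<inter> G)" if F: "F \<subseteq> {1..n}" for F
  proof -
    have "dint (block_product (insert F ((\<lambda>i. {i}) ` ({1..n} - F))) P) (\<lambda>x. \<Prod>i\<in>G. of_bool (x i \<in> A i))
        = (\<Prod>B\<in>insert F ((\<lambda>i. {i}) ` ({1..n} - F)). p (G \<inter> B))"
      unfolding p_def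
      by (rule dint_block_product[OF Pd(1) lancaster_blocks(1)[OF F] _ lancaster_blocks(2)[OF F] G(1)]) simp
    also have "\<dots> = p (G \<inter> F) * (\<Prod>B\<in>(\<lambda>i. {i}) ` ({1..n} - F). p (G \<inter> B))"
      by (rule prod.insert) auto
    also have "(\<Prod>B\<in>(\<lambda>i. {i}) ` ({1..n} - F). p (G \<inter> B)) = (\<Prod>i\<in>{1..n} - F. p (G \<inter> {i}))"
      by (subst prod.reindex) (auto simp: inj_on_def)
    also have "\<dots> = (\<Prod>i\<in>G - (F \<inter> G). p {i})"
    proof (rule prod.mono_neutral_cong_right)
      show "\<forall>i\<in>({1..n} - F) - (G - (F \<inter> G)). p (G \<inter> {i}) = 1"
      proof
        fix i assume "i \<in> ({1..n} - F) - (G - (F \<inter> G))"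
        then have "G \<inter> {i} = {}" by auto
        then show "p (G \<inter> {i}) = 1" using Pd(2) by (simp add: p_def)
      qed
      show "p (G \<inter> {i}) = p {i}" if "i \<in> G - (F \<inter> G)" for i
        using that by (simp add: Int_absorb1)
    qed (use G in auto)
    finally show ?thesis by (simp add: a_def Int_commute)
  qed
  then show "dint (lancaster k n P) (\<lambda>x. \<Prod>i\<in>G. of_bool (x i \<in> A i)) = 0"
    using lancaster_sum[OF G \<open>k \<le> n\<close>, of a]
    by (simp add: dint_lancaster[OF Pd(1)] a_def p_def cong: conj_cong)
qed


section \<open>The Streitberg interaction has vanishing marginals\<close>

text \<open>
  The partitions of \<open>insert e I\<close> arise from those of \<open>I\<close> by adding \<open>e\<close> to a block or as a singleton.
  If \<open>\<phi>\<close> does not see \<open>e\<close>, the \<open>\<ell>\<close> partitions of the first kind over a partition with \<open>\<ell>\<close> blocks cancel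
  the one of the second kind, as \<open>\<ell> * (\<ell> - 1)! = \<ell>!\<close>.
\<close>

lemma sum_partitions_insert_eq_0:
  fixes \<phi> :: "'a set \<Rightarrow> real"
  assumes "finite I" "I \<noteq> {}" and e: "e \<notin> I"
    and \<phi>: "\<And>B. \<phi> (insert e B) = \<phi> B" "\<phi> {} = 1"
  shows "(\<Sum>\<pi> | partition_on (insert e I) \<pi>. (-1) ^ (card \<pi> - 1) * fact (card \<pi> - 1) * (\<Prod>B\<in>\<pi>. \<phi> B)) = 0"
proof -
  define w where "w \<pi> = (-1) ^ (card \<pi> - 1) * fact (card \<pi> - 1) * (\<Prod>B\<in>\<pi>. \<phi> B)" for \<pi>
  \<comment> \<open>\<open>b = {}\<close> stands for the choice of a singleton, and \<open>down\<close> is the inverse of \<open>up\<close>.\<close>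
  define up where "up = (\<lambda>(\<pi>, b). insert (insert e b) (\<pi> - {b}))"
  define rest where "rest \<pi> = (THE B. B \<in> \<pi> \<and> e \<in> B) - {e}" for \<pi>
  define down where "down \<pi> = (insert (rest \<pi>) {B \<in> \<pi>. e \<notin> B} - {{}}, rest \<pi>)" for \<pi>
  have the: "(THE B. B \<in> \<pi> \<and> e \<in> B) = B" if "disjoint \<pi>" "B \<in> \<pi>" "e \<in> B" for B \<pi>
    using that by (intro the_equality) (auto simp: disjoint_def)
  have "(\<Sum>\<pi> | partition_on (insert e I) \<pi>. w \<pi>)
      = (\<Sum>(\<pi>, b)\<in>Sigma {\<pi>. partition_on I \<pi>} (insert {}). w (up (\<pi>, b)))"
  proof (rule sum.reindex_bij_witness[where i = up and j = down])
    fix \<pi> assume "\<pi> \<in> {\<pi>. partition_on (insert e I) \<pi>}"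
    then have \<pi>: "\<Union>\<pi> = insert e I" "disjoint \<pi>" "{} \<notin> \<pi>"
      by (auto simp: partition_on_def)
    then obtain B where B: "B \<in> \<pi>" "e \<in> B" by blast
    have rest: "rest \<pi> = B - {e}" by (simp add: rest_def the[OF \<pi>(2) B])
    have others: "{B \<in> \<pi>. e \<notin> B} = \<pi> - {B}" using B \<pi>(2) by (auto simp: disjoint_def)
    have new: "B - {e} \<notin> \<pi>"
    proof
      assume *: "B - {e} \<in> \<pi>"
      have "B - {e} \<noteq> B" using B by auto
      then have "(B - {e}) \<inter> B = {}" using disjointD[OF \<pi>(2) * B(1)] by simp
      then show False using * \<pi>(3) by (metis Diff_subset Int_absorb2)
    qed
    show up: "up (down \<pi>) = \<pi>"
      using B new \<pi>(3) by (auto simp: up_def down_def rest others insert_absorb)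
    have B_dis: "C \<inter> B = {}" if "C \<in> \<pi>" "C \<noteq> B" for C
      by (rule disjointD[OF \<pi>(2) that(1) B(1) that(2)])
    have "\<Union>(\<pi> - {B}) = insert e I - B" using B_dis B(1) unfolding \<pi>(1)[symmetric] by blast
    moreover have "\<Union>(insert (B - {e}) (\<pi> - {B}) - {{}}) = (B - {e}) \<union> \<Union>(\<pi> - {B})" by auto
    moreover have "B \<subseteq> insert e I" using B(1) \<pi>(1) by auto
    ultimately have "\<Union>(insert (B - {e}) (\<pi> - {B}) - {{}}) = I" using B(2) e by auto
    moreover have "disjoint (insert (B - {e}) (\<pi> - {B}) - {{}})"
    proof (rule pairwise_subset[of _ "insert (B - {e}) (\<pi> - {B})"])
      have "disjnt (B - {e}) C" if "C \<in> \<pi> - {B}" for C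
        using B_dis[of C] that by (auto simp: disjnt_def)
      then show "disjoint (insert (B - {e}) (\<pi> - {B}))"
        using pairwise_subset[OF \<pi>(2), of "\<pi> - {B}"] by (auto simp: pairwise_insert disjnt_sym)
    qed auto
    ultimately show "down \<pi> \<in> Sigma {\<pi>. partition_on I \<pi>} (insert {})"
      by (auto simp: down_def rest others partition_on_def)
    show "(case down \<pi> of (\<pi>, b) \<Rightarrow> w (up (\<pi>, b))) = w \<pi>" using up by (simp add: case_prod_unfold)
  next
    fix pb assume "pb \<in> Sigma {\<pi>. partition_on I \<pi>} (insert {})"
    then obtain \<pi> b where pb: "pb = (\<pi>, b)" and \<pi>: "\<Union>\<pi> = I" "disjoint \<pi>" "{} \<notin> \<pi>" and b: "b = {} \<or> b \<in> \<pi>"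
      by (auto simp: partition_on_def)
    have eb: "e \<notin> b" "\<And>B. B \<in> \<pi> \<Longrightarrow> e \<notin> B" using b e \<pi>(1) by auto
    have b_dis: "C \<inter> b = {}" if "C \<in> \<pi>" "C \<noteq> b" for C
      using b disjointD[OF \<pi>(2) that(1) _ that(2)] by auto
    have dis: "disjoint (up pb)"
    proof -
      have "disjnt (insert e b) C" if "C \<in> \<pi> - {b}" for C
        using b_dis[of C] eb(2)[of C] that by (auto simp: disjnt_def)
      then show ?thesis
        using pairwise_subset[OF \<pi>(2), of "\<pi> - {b}"]
        by (auto simp: up_def pb pairwise_insert disjnt_sym)
    qed
    have "rest (up pb) = insert e b - {e}"
      unfolding rest_def by (subst the[OF dis, of "insert e b"]) (auto simp: up_def pb)
    then have rest: "rest (up pb) = b" using eb by auto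
    have others: "{B \<in> up pb. e \<notin> B} = \<pi> - {b}" using eb by (auto simp: up_def pb)
    have "insert b (\<pi> - {b}) - {{}} = \<pi>" using b \<pi>(3) by blast
    then show "down (up pb) = pb" unfolding down_def rest others by (simp only: pb)
    have "\<Union>(up pb) = insert e I" using b \<pi>(1) by (auto simp: up_def pb)
    then show "up pb \<in> {\<pi>. partition_on (insert e I) \<pi>}"
      using dis \<pi>(3) by (auto simp: partition_on_def up_def pb)
  qed
  also have "\<dots> = (\<Sum>\<pi> | partition_on I \<pi>. \<Sum>b\<in>insert {} \<pi>. w (up (\<pi>, b)))"
    using finitely_many_partition_on[OF \<open>finite I\<close>] finite_elements[OF \<open>finite I\<close>]
    by (subst sum.Sigma) auto
  also have "\<dots> = 0"
  proof (rule sum.neutral, safe)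
    fix \<pi> assume \<pi>: "partition_on I \<pi>"
    have fin: "finite \<pi>" by (rule finite_elements[OF \<open>finite I\<close> \<pi>])
    have ne: "{} \<notin> \<pi>" "\<pi> \<noteq> {}" using \<pi> \<open>I \<noteq> {}\<close> by (auto simp: partition_on_def)
    have fresh: "insert e b \<notin> \<pi>" for b using \<pi> e by (auto simp: partition_on_def)
    define c where "c = (\<Prod>B\<in>\<pi>. \<phi> B)"
    have card: "card \<pi> = Suc (card \<pi> - 1)" using ne fin by (simp add: card_gt_0_iff)
    have "w (up (\<pi>, {})) = (-1) ^ card \<pi> * fact (card \<pi>) * c"
      using fin ne fresh[of "{}"] \<phi> by (simp add: w_def up_def c_def)
    moreover have "w (up (\<pi>, b)) = (-1) ^ (card \<pi> - 1) * fact (card \<pi> - 1) * c" if "b \<in> \<pi>" for b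
      using fin fresh[of b] \<phi>(1)[of b] that prod.remove[OF fin that, of \<phi>] card
      by (simp add: w_def up_def c_def card_insert_if)
    ultimately have "(\<Sum>b\<in>insert {} \<pi>. w (up (\<pi>, b))) = (-1) ^ card \<pi> * fact (card \<pi>) * c
        + real (card \<pi>) * ((-1) ^ (card \<pi> - 1) * fact (card \<pi> - 1) * c)"
      using fin ne by simp
    also have "\<dots> = 0" by (subst (1 2 3) card) (simp add: algebra_simps)
    finally show "(\<Sum>b\<in>insert {} \<pi>. w (up (\<pi>, b))) = 0" .
  qed
  finally show ?thesis by (simp add: w_def)
qed

lemma dint_streitberg:
  assumes P: "discrete_measure (Pi\<^sub>E {1..n} X) P"
  shows "dint (streitberg n P) f = (\<Sum>\<pi> | partition_on {1..n} \<pi>.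
    (-1) ^ (card \<pi> - 1) * fact (card \<pi> - 1) * dint (block_product \<pi> P) f)"
proof -
  have summand: "discrete_measure (Pi\<^sub>E {1..n} X)
      (\<lambda>x. (-1) ^ (card \<pi> - 1) * fact (card \<pi> - 1) * block_product \<pi> P x)"
    if "\<pi> \<in> {\<pi>. partition_on {1..n} \<pi>}" for \<pi>
    using that
    by (intro discrete_measure_scale discrete_measure_block_product[OF P]) (simp_all add: partition_on_def)
  show ?thesis
    unfolding streitberg_def[abs_def]
    by (rule trans[OF dint_measure_sum], erule summand, simp only: dint_measure_scale)
qed

lemma streitberg_M_space:
  assumes P: "discrete_prob (Pi\<^sub>E {1..n} X) P" and "2 \<le> n"
  shows "streitberg n P \<in> M_space n n X"
proof (rule M_spaceI[OF _ order_refl])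
  note Pd = discrete_prob_dint_1[OF P]
  show "discrete_measure (Pi\<^sub>E {1..n} X) (streitberg n P)"
    by (rule discrete_measure_streitberg[OF Pd(1)])
  fix G A assume G: "G \<subseteq> {1..n}" "card G < n"
  then have "G \<noteq> {1..n}" by auto
  then obtain e where e: "e \<in> {1..n}" "e \<notin> G" using G(1) by blast
  define \<phi> where "\<phi> B = dint P (\<lambda>x. \<Prod>i\<in>G \<inter> B. of_bool (x i \<in> A i))" for B
  have "dint (streitberg n P) (\<lambda>x. \<Prod>i\<in>G. of_bool (x i \<in> A i))
      = (\<Sum>\<pi> | partition_on {1..n} \<pi>. (-1) ^ (card \<pi> - 1) * fact (card \<pi> - 1) * (\<Prod>B\<in>\<pi>. \<phi> B))"
    unfolding dint_streitberg[OF Pd(1)] \<phi>_def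
  proof (rule sum.cong[OF refl], rule arg_cong[where f = "\<lambda>z. _ * z"])
    fix \<pi> assume "\<pi> \<in> {\<pi>. partition_on {1..n} \<pi>}"
    then show "dint (block_product \<pi> P) (\<lambda>x. \<Prod>i\<in>G. of_bool (x i \<in> A i))
        = (\<Prod>B\<in>\<pi>. dint P (\<lambda>x. \<Prod>i\<in>G \<inter> B. of_bool (x i \<in> A i)))"
      by (intro dint_block_product[OF Pd(1) _ _ _ G(1)]) (auto simp: partition_on_def)
  qed
  also have "{1..n} = insert e ({1..n} - {e})" using e by auto
  also have "(\<Sum>\<pi> | partition_on (insert e ({1..n} - {e})) \<pi>.
      (-1) ^ (card \<pi> - 1) * fact (card \<pi> - 1) * (\<Prod>B\<in>\<pi>. \<phi> B)) = 0"
  proof (rule sum_partitions_insert_eq_0)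
    show "{1..n} - {e} \<noteq> {}"
    proof
      assume "{1..n} - {e} = {}"
      then have "card {1..n} \<le> card {e}" by (intro card_mono) auto
      then show False using \<open>2 \<le> n\<close> by simp
    qed
    show "\<phi> (insert e B) = \<phi> B" for B using e by (simp add: \<phi>_def)
    show "\<phi> {} = 1" using Pd(2) by (simp add: \<phi>_def)
  qed auto
  finally show "dint (streitberg n P) (\<lambda>x. \<Prod>i\<in>G. of_bool (x i \<in> A i)) = 0" .
qed


section \<open>A law whose interactions are the witness\<close>

definition perturbed_uniform :: "nat \<Rightarrow> (nat \<Rightarrow> nat \<Rightarrow> real) \<Rightarrow> real" where
  "perturbed_uniform n x = tensor n uniform3 x + witness n x"

lemma discrete_measure_perturbed_uniform:
  "discrete_measure (\<Pi>\<^sub>E i\<in>{1..n}. Rd 1) (perturbed_uniform n)"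
  unfolding perturbed_uniform_def[abs_def]
  by (intro discrete_measure_add discrete_measure_tensor discrete_uniform3 discrete_second_difference)

lemma dint_perturbed_uniform:
  "dint (perturbed_uniform n) f = dint (tensor n uniform3) f + dint (witness n) f"
  unfolding perturbed_uniform_def[abs_def]
  by (rule dint_measure_add[OF discrete_measure_tensor[OF discrete_uniform3]
        discrete_measure_tensor[OF discrete_second_difference]])

lemma discrete_prob_perturbed_uniform:
  assumes "n \<ge> 1"
  shows "discrete_prob (\<Pi>\<^sub>E i\<in>{1..n}. Rd 1) (perturbed_uniform n)"
  unfolding discrete_prob_def
proof (intro conjI allI discrete_measure_perturbed_uniform)
  let ?S = "\<Pi>\<^sub>E i\<in>{1..n}. Rd 1"
  fix x
  have "\<bar>second_difference y\<bar> \<le> uniform3 y" for y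
    by (auto simp: second_difference_def uniform3_def)
  then have "\<bar>\<Prod>i=1..n. second_difference (x i)\<bar> \<le> (\<Prod>i=1..n. uniform3 (x i))"
    unfolding abs_prod by (intro prod_mono) simp
  then show "0 \<le> perturbed_uniform n x" by (auto simp: perturbed_uniform_def tensor_def)
next
  let ?S = "\<Pi>\<^sub>E i\<in>{1..n}. Rd 1"
  have S: "perturbed_uniform n x \<noteq> 0 \<Longrightarrow> x \<in> ?S" for x
    using discrete_measure_perturbed_uniform[of n] by (auto simp: discrete_measure_def)
  have "dmass (perturbed_uniform n) ?S = dint (perturbed_uniform n) (\<lambda>x. of_bool (x \<in> ?S))"
    using discrete_measure_perturbed_uniform by (intro dmass_eq_dint) (simp add: discrete_measure_def)
  also have "\<dots> = dint (perturbed_uniform n) (\<lambda>_. 1)"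
    by (rule dint_cong, drule S) (simp del: One_nat_def)
  also have "\<dots> = 1"
    using assms dint_tensor_cylinder[OF discrete_uniform3, of "{}" n]
      dint_tensor_cylinder[OF discrete_second_difference, of "{}" n]
    by (simp add: dint_perturbed_uniform dint_uniform3 dint_second_difference)
  finally show "dmass (perturbed_uniform n) ?S = 1" .
qed

lemma dint_point:
  assumes "discrete_measure S \<tau>"
  shows "dint \<tau> (\<lambda>y. of_bool (y = a)) = \<tau> a"
proof -
  have "dint \<tau> (\<lambda>y. of_bool (y = a)) = (\<Sum>y | \<tau> y \<noteq> 0. if y = a then \<tau> y else 0)"
    unfolding dint_def by (intro sum.cong) auto
  then show ?thesis using assms by (simp add: discrete_measure_def)
qed

text \<open>
  The second difference has total mass zero, so the perturbation contributes nothing to the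
  marginals on proper subsets of the coordinates.
\<close>

lemma marginal_perturbed_uniform:
  assumes B: "B \<subseteq> {1..n}" "B \<noteq> {1..n}"
  shows "marginal B (perturbed_uniform n) (restrict x B) = (\<Prod>i\<in>B. uniform3 (x i))"
proof -
  have finB: "finite B" using B finite_subset by blast
  have cardB: "card B < n" using psubset_card_mono[of "{1..n}" B] B by auto
  have "marginal B (perturbed_uniform n) (restrict x B)
      = dint (perturbed_uniform n) (\<lambda>z. of_bool (restrict z B = restrict x B))"
    unfolding marginal_def using discrete_measure_perturbed_uniform[of n]
    by (subst dmass_eq_dint) (simp_all add: discrete_measure_def)
  also have "\<dots> = dint (perturbed_uniform n) (\<lambda>z. \<Prod>i\<in>B. of_bool (z i = x i))"
    by (rule dint_cong) (auto simp: prod_of_bool[OF finB] restrict_def fun_eq_iff)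
  also have "\<dots> = (\<Prod>i\<in>B. uniform3 (x i))"
    using cardB
    by (simp add: dint_perturbed_uniform dint_uniform3[of "\<lambda>_. 1"] dint_second_difference[of "\<lambda>_. 1"]
        dint_tensor_cylinder[OF discrete_uniform3 B(1), of "\<lambda>i y. of_bool (y = x i)"]
        dint_tensor_cylinder[OF discrete_second_difference B(1), of "\<lambda>i y. of_bool (y = x i)"]
        dint_point[OF discrete_uniform3])
  finally show ?thesis .
qed

lemma block_product_perturbed_uniform:
  assumes I: "\<Union>\<pi> = {1..n}" and dis: "disjoint \<pi>" and proper: "{1..n} \<notin> \<pi>"
  shows "block_product \<pi> (perturbed_uniform n) x = tensor n uniform3 x"
proof (cases "x \<in> extensional {1..n}")
  case True
  have sub: "B \<subseteq> {1..n}" if "B \<in> \<pi>" for B using I that by auto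
  have "block_product \<pi> (perturbed_uniform n) x = (\<Prod>B\<in>\<pi>. marginal B (perturbed_uniform n) (restrict x B))"
    unfolding block_product_def I using True by simp
  also have "\<dots> = (\<Prod>B\<in>\<pi>. \<Prod>i\<in>B. uniform3 (x i))"
    using sub proper by (intro prod.cong refl marginal_perturbed_uniform) auto
  also have "\<dots> = (\<Prod>i\<in>\<Union>\<pi>. uniform3 (x i))"
    using finite_subset[OF sub] dis by (subst prod.Union_disjoint) (auto simp: disjoint_def)
  finally show ?thesis using True I by (simp add: tensor_def)
next
  case False
  then show ?thesis unfolding block_product_def I by (simp add: tensor_def)
qed

text \<open>
  All products of proper marginals equal the unperturbed law, and the sum of their coefficients
  is \<open>-1\<close>.
\<close>

lemma lancaster_perturbed_uniform:
  assumes "0 < k" "k \<le> n" "2 \<le> n"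
  shows "lancaster k n (perturbed_uniform n) = witness n"
proof
  fix x
  define c where "c j = (-1) ^ (k - j) * real ((n - j - 1) choose (n - k))" for j
  have "block_product (insert F ((\<lambda>i. {i}) ` ({1..n} - F))) (perturbed_uniform n) x = tensor n uniform3 x"
    if F: "F \<subseteq> {1..n}" "card F < k" for F
  proof (rule block_product_perturbed_uniform[OF lancaster_blocks[OF F(1)]])
    have "card {1..n} \<noteq> card F" "card {1..n} \<noteq> card {i}" for i using F(2) assms by auto
    then show "{1..n} \<notin> insert F ((\<lambda>i. {i}) ` ({1..n} - F))" by force
  qed
  then have "(\<Sum>j<k. c j * (\<Sum>F | F \<subseteq> {1..n} \<and> card F = j.
      block_product (insert F ((\<lambda>i. {i}) ` ({1..n} - F))) (perturbed_uniform n) x))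
      = (\<Sum>j<k. c j * (\<Sum>F | F \<subseteq> {1..n} \<and> card F = j. tensor n uniform3 x))"
    by (intro sum.cong refl arg_cong[where f = "\<lambda>z. _ * z"]) auto
  also have "\<dots> = - tensor n uniform3 x"
    unfolding c_def using assms by (intro lancaster_sum[of "{}" n k "\<lambda>_. tensor n uniform3 x"]) auto
  finally show "lancaster k n (perturbed_uniform n) x = witness n x"
    unfolding lancaster_def c_def by (simp add: perturbed_uniform_def)
qed

lemma streitberg_perturbed_uniform:
  assumes "2 \<le> n"
  shows "streitberg n (perturbed_uniform n) = witness n"
proof
  fix x
  define c :: "nat set set \<Rightarrow> real" where "c \<pi> = (-1) ^ (card \<pi> - 1) * fact (card \<pi> - 1)" for \<pi>
  define Q where "Q = {\<pi>. partition_on {1..n} \<pi>}"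
  have finQ: "finite Q" unfolding Q_def by (rule finitely_many_partition_on) simp
  have top: "{{1..n}} \<in> Q" using assms by (auto simp: Q_def partition_on_def)
  have "{1..n} = insert n {1..n - 1}" using assms by auto
  \<comment> \<open>the cancellation of total masses, for \<open>\<phi> = 1\<close>\<close>
  then have "sum c Q = 0"
    using assms sum_partitions_insert_eq_0[of "{1..n - 1}" n "\<lambda>_. 1"] by (simp add: Q_def c_def)
  then have rest: "sum c (Q - {{{1..n}}}) = - 1"
    using sum.remove[OF finQ top, of c] by (simp add: c_def)
  have "streitberg n (perturbed_uniform n) x = (\<Sum>\<pi>\<in>Q. c \<pi> * block_product \<pi> (perturbed_uniform n) x)"
    by (simp add: streitberg_def Q_def c_def)
  also have "\<dots> = c {{1..n}} * block_product {{1..n}} (perturbed_uniform n) x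
      + (\<Sum>\<pi>\<in>Q - {{{1..n}}}. c \<pi> * block_product \<pi> (perturbed_uniform n) x)"
    by (rule sum.remove[OF finQ top])
  also have "block_product {{1..n}} (perturbed_uniform n) x = perturbed_uniform n x"
  proof (cases "x \<in> extensional {1..n}")
    case True
    have fin: "finite {z. perturbed_uniform n z \<noteq> 0}"
      using discrete_measure_perturbed_uniform[of n] by (simp add: discrete_measure_def)
    have "marginal {1..n} (perturbed_uniform n) (restrict x {1..n})
        = dint (perturbed_uniform n) (\<lambda>z. of_bool (z \<in> {z. restrict z {1..n} = restrict x {1..n}}))"
      unfolding marginal_def by (rule dmass_eq_dint[OF fin])
    also have "\<dots> = dint (perturbed_uniform n) (\<lambda>z. of_bool (z = x))"
    proof (rule dint_cong)
      fix z assume "perturbed_uniform n z \<noteq> 0"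
      then have "z \<in> extensional {1..n}"
        by (auto simp: perturbed_uniform_def tensor_def split: if_splits)
      then show "of_bool (z \<in> {z. restrict z {1..n} = restrict x {1..n}}) = (of_bool (z = x) :: real)"
        using True by (auto simp: extensional_restrict)
    qed
    also have "\<dots> = perturbed_uniform n x" by (rule dint_point[OF discrete_measure_perturbed_uniform])
    finally show ?thesis using True by (simp add: block_product_def)
  next
    case False
    then show ?thesis by (simp add: block_product_def perturbed_uniform_def tensor_def)
  qed
  also have "(\<Sum>\<pi>\<in>Q - {{{1..n}}}. c \<pi> * block_product \<pi> (perturbed_uniform n) x)
      = (\<Sum>\<pi>\<in>Q - {{{1..n}}}. c \<pi> * tensor n uniform3 x)"
  proof (rule sum.cong[OF refl])
    fix \<pi> assume \<pi>: "\<pi> \<in> Q - {{{1..n}}}"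
    then have U: "\<Union>\<pi> = {1..n}" "disjoint \<pi>" "{} \<notin> \<pi>" by (auto simp: Q_def partition_on_def)
    have "{1..n} \<notin> \<pi>"
    proof
      assume *: "{1..n} \<in> \<pi>"
      have "B = {1..n}" if "B \<in> \<pi>" for B
      proof (rule ccontr)
        assume "B \<noteq> {1..n}"
        then have "B \<inter> {1..n} = {}" using disjointD[OF U(2) that *] by simp
        moreover have "B \<subseteq> {1..n}" using U(1) that by blast
        ultimately show False using that U(3) by (metis Int_absorb2)
      qed
      then have "\<pi> = {{1..n}}" using * by blast
      then show False using \<pi> by simp
    qed
    then show "c \<pi> * block_product \<pi> (perturbed_uniform n) x = c \<pi> * tensor n uniform3 x"
      by (simp add: block_product_perturbed_uniform[OF U(1,2)])
  qed
  also have "\<dots> = - tensor n uniform3 x"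
    unfolding sum_distrib_right[symmetric] rest by simp
  finally show "streitberg n (perturbed_uniform n) x = witness n x"
    by (simp add: c_def perturbed_uniform_def[of n x])
qed


section \<open>The characterisations of strictness\<close>

theorem corollary6p12:
  fixes n k :: nat
    and g :: "(nat \<Rightarrow> real) \<Rightarrow> real"
    and \<eta> :: "(nat \<Rightarrow> real) measure"
  assumes "n \<ge> 1" and "k \<le> n"
    and "continuous_on (orthant {1..n}) g"
    and "PDI k n g"
    and "\<forall>t \<in> bdry k {1..n}. g t = 0"
    and "representing_measure k n g \<eta>"
  shows "(SPDI k n g \<longleftrightarrow> measure \<eta> (open_orthant {1..n}) > 0)
    \<and> (k \<ge> 2 \<longrightarrow>
        (SPDI k n g \<longleftrightarrow>
          (\<forall>d. \<forall>P. discrete_prob (\<Pi>\<^sub>E i\<in>{1..n}. Rd d) P \<longrightarrow>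
            (dint (lancaster k n P) (\<lambda>y. dint (lancaster k n P) (\<lambda>x. g (sqdists n d x y))) = 0
              \<longleftrightarrow> lancaster k n P = (\<lambda>_. 0)))))
    \<and> (k = n \<and> n \<ge> 2 \<longrightarrow>
        (SPDI n n g \<longleftrightarrow>
          (\<forall>d. \<forall>P. discrete_prob (\<Pi>\<^sub>E i\<in>{1..n}. Rd d) P \<longrightarrow>
            (dint (streitberg n P)
                (\<lambda>y. dint (streitberg n P) (\<lambda>x. (-1) ^ n * g (sqdists n d x y))) = 0
              \<longleftrightarrow> streitberg n P = (\<lambda>_. 0)))))"
  unfolding qform_def[symmetric]
proof (intro conjI impI)
  note charged = strictness_dichotomy(1)[OF \<open>k \<le> n\<close> \<open>PDI k n g\<close> \<open>representing_measure k n g \<eta>\<close>]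
  note null = strictness_dichotomy(2)[OF \<open>k \<le> n\<close> \<open>PDI k n g\<close> \<open>representing_measure k n g \<eta>\<close>]
  have strict: "\<mu> = (\<lambda>_. 0)"
    if "SPDI k n g" "\<mu> \<in> M_space k n (\<lambda>_. Rd d)" "qform \<mu> (\<lambda>u v. g (sqdists n d u v)) = 0" for \<mu> d
    using that by (simp add: SPDI_qform qform_mult)
  have witness: "witness n \<in> M_space k n (\<lambda>_. Rd 1)"
    by (rule M_space_mono[OF witness_M_space \<open>k \<le> n\<close> order_refl])
  have charged_iff: "SPDI k n g" if "qform (witness n) (\<lambda>u v. g (sqdists n 1 u v)) \<noteq> 0"
    using charged null that by (metis measure_nonneg order_le_less)
  show "SPDI k n g \<longleftrightarrow> 0 < measure \<eta> (open_orthant {1..n})"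
    using charged null strict[OF _ witness] witness_nonzero
    by (metis measure_nonneg order_le_less)
  have zero: "qform (\<lambda>_. 0) h = 0" for h :: "'a \<Rightarrow> 'a \<Rightarrow> real" by (simp add: qform_def dint_def)
  show "SPDI k n g \<longleftrightarrow> (\<forall>d P. discrete_prob (\<Pi>\<^sub>E i\<in>{1..n}. Rd d) P \<longrightarrow>
      (qform (lancaster k n P) (\<lambda>x y. g (sqdists n d x y)) = 0 \<longleftrightarrow> lancaster k n P = (\<lambda>_. 0)))"
    if "2 \<le> k"
  proof
    assume spdi: "SPDI k n g"
    show "\<forall>d P. discrete_prob (\<Pi>\<^sub>E i\<in>{1..n}. Rd d) P \<longrightarrow>
      (qform (lancaster k n P) (\<lambda>x y. g (sqdists n d x y)) = 0 \<longleftrightarrow> lancaster k n P = (\<lambda>_. 0))"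
    proof (intro allI impI iffI)
      fix d P assume "discrete_prob (\<Pi>\<^sub>E i\<in>{1..n}. Rd d) P"
      then have "lancaster k n P \<in> M_space k n (\<lambda>_. Rd d)" by (rule lancaster_M_space[OF _ \<open>k \<le> n\<close>])
      then show "lancaster k n P = (\<lambda>_. 0)"
        if "qform (lancaster k n P) (\<lambda>x y. g (sqdists n d x y)) = 0"
        using that by (rule strict[OF spdi])
    qed (simp add: zero)
  next
    assume test: "\<forall>d P. discrete_prob (\<Pi>\<^sub>E i\<in>{1..n}. Rd d) P \<longrightarrow>
      (qform (lancaster k n P) (\<lambda>x y. g (sqdists n d x y)) = 0 \<longleftrightarrow> lancaster k n P = (\<lambda>_. 0))"
    have "lancaster k n (perturbed_uniform n) = witness n"
      using that \<open>k \<le> n\<close> by (intro lancaster_perturbed_uniform) auto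
    then show "SPDI k n g"
      using test[rule_format, OF discrete_prob_perturbed_uniform[OF \<open>n \<ge> 1\<close>]] witness_nonzero
      by (intro charged_iff) simp
  qed
  show "SPDI n n g \<longleftrightarrow> (\<forall>d P. discrete_prob (\<Pi>\<^sub>E i\<in>{1..n}. Rd d) P \<longrightarrow>
      (qform (streitberg n P) (\<lambda>x y. (-1) ^ n * g (sqdists n d x y)) = 0 \<longleftrightarrow> streitberg n P = (\<lambda>_. 0)))"
    if kn: "k = n \<and> 2 \<le> n"
  proof
    assume "SPDI n n g"
    then have spdi: "SPDI k n g" using kn by simp
    show "\<forall>d P. discrete_prob (\<Pi>\<^sub>E i\<in>{1..n}. Rd d) P \<longrightarrow>
      (qform (streitberg n P) (\<lambda>x y. (-1) ^ n * g (sqdists n d x y)) = 0 \<longleftrightarrow> streitberg n P = (\<lambda>_. 0))"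
    proof (intro allI impI iffI)
      fix d P assume "discrete_prob (\<Pi>\<^sub>E i\<in>{1..n}. Rd d) P"
      then have "streitberg n P \<in> M_space k n (\<lambda>_. Rd d)"
        using streitberg_M_space[of n "\<lambda>_. Rd d" P] kn by (simp del: One_nat_def)
      moreover assume "qform (streitberg n P) (\<lambda>x y. (-1) ^ n * g (sqdists n d x y)) = 0"
      then have "qform (streitberg n P) (\<lambda>x y. g (sqdists n d x y)) = 0"
        by (simp add: qform_mult)
      ultimately show "streitberg n P = (\<lambda>_. 0)" by (rule strict[OF spdi])
    qed (simp add: zero)
  next
    assume test: "\<forall>d P. discrete_prob (\<Pi>\<^sub>E i\<in>{1..n}. Rd d) P \<longrightarrow>
      (qform (streitberg n P) (\<lambda>x y. (-1) ^ n * g (sqdists n d x y)) = 0 \<longleftrightarrow> streitberg n P = (\<lambda>_. 0))"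
    have "streitberg n (perturbed_uniform n) = witness n"
      using kn by (intro streitberg_perturbed_uniform) auto
    then show "SPDI n n g"
      using test[rule_format, OF discrete_prob_perturbed_uniform[OF \<open>n \<ge> 1\<close>]] witness_nonzero
        charged_iff kn by (simp add: qform_mult)
  qed
qed

end
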